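(* Let $n \geq 4$ and for $1\le i\le n-1$ let $s_i=(i,i+1)\in S_n$. \begin{enumerate} \item A real representation $\pi$ of $S_n$ is spinorial if and only if $\chi_\pi(1) \equiv \chi_\pi(s_1s_3) \pmod 8$ and $\chi_\pi(1)-\chi_\pi(s_1)$ is congruent to $0$ or $6 \pmod 8$. \item A real representation $\pi$ of the alternating group $A_n$ is spinorial if and only if $\chi_\pi(1) \equiv \chi_\pi(s_1s_3) \pmod 8$. \end{enumerate}
   Context: All representations are finite-dimensional real representations, and $\chi_\pi$ denotes the character of $\pi$. A real representation of a finite group $G$ on a Euclidean space $V$ is regarded (after conjugation) as a homomorphism $\pi: G\to \mathrm{O}(V)$. Let $C(V)$ be the Clifford algebra of $V$ (quotient of the tensor algebra by the ideal generated by $v\otimes v+|v|^2$), $\mathrm{Pin}(V)\subset C(V)^\times$ the Pin group, and $\rho:\mathrm{Pin}(V)\to \mathrm{O}(V)$ the standard double cover with kernel $\{\pm1\}$ (for a unit vector $v$, $\rho(v)$ is the reflection in $v^\perp$). The representation $\pi$ is called spinorial if there is a homomorphism $\hat\pi: G\to\mathrm{Pin}(V)$ with $\rho\circ\hat\pi=\pi$. *)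

theory Defs
  imports "HOL-Analysis.Analysis" "HOL-Algebra.Sym_Groups"
begin

text \<open>Concrete model of the Clifford algebra C(V) of V = real^'n (standard inner product),
  with the convention v*v = -|v|^2.  An element is given by its coordinates with respect to
  the basis e_S, S a subset of the index type, where e_S = e_{s1}...e_{sk} with s1 < ... < sk
  (ordering given by the linorder on the index type), and e_i e_j = - e_j e_i (i ~= j),
  e_i e_i = -1.\<close>

type_synonym 'n clifford = "'n set \<Rightarrow> real"

definition cl_sign :: "'n::{finite,linorder} set \<Rightarrow> 'n set \<Rightarrow> real" where
  "cl_sign S T = (-1) ^ (card {(s,t). s \<in> S \<and> t \<in> T \<and> t < s} + card (S \<inter> T))"

definition cl_mult :: "'n::{finite,linorder} clifford \<Rightarrow> 'n clifford \<Rightarrow> 'n clifford" where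
  "cl_mult x y = (\<lambda>U. \<Sum>S\<in>UNIV. \<Sum>T\<in>UNIV.
      if (S - T) \<union> (T - S) = U then cl_sign S T * x S * y T else 0)"

definition cl_one :: "'n::{finite,linorder} clifford" where
  "cl_one = (\<lambda>S. if S = {} then 1 else 0)"

definition cl_vec :: "real^'n::{finite,linorder} \<Rightarrow> 'n clifford" where
  "cl_vec v = (\<lambda>S. if (\<exists>i. S = {i}) then v $ (the_elem S) else 0)"

text \<open>The grade (parity) automorphism alpha of C(V), induced by v \<mapsto> -v.\<close>
definition cl_grade :: "'n::{finite,linorder} clifford \<Rightarrow> 'n clifford" where
  "cl_grade x = (\<lambda>S. (-1) ^ card S * x S)"

definition cl_inverse :: "'n::{finite,linorder} clifford \<Rightarrow> 'n clifford" where
  "cl_inverse x = (SOME y. cl_mult x y = cl_one \<and> cl_mult y x = cl_one)"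

text \<open>Pin(V): the subgroup of the units of C(V) generated by the unit vectors
  (finite products of unit vectors; the inverse of a unit vector v is the unit vector -v).\<close>
definition Pin :: "'n::{finite,linorder} clifford set" where
  "Pin = {x. \<exists>vs :: (real^'n::{finite,linorder}) list. (\<forall>v\<in>set vs. norm v = 1) \<and>
                 x = foldr cl_mult (map cl_vec vs) cl_one}"

text \<open>The standard double cover rho : Pin(V) \<rightarrow> O(V) (twisted adjoint action
  w \<mapsto> alpha(x) w x^{-1}); for a unit vector v, rho(v) is the reflection in v^\<bottom>.\<close>
definition pin_rho :: "'n::{finite,linorder} clifford \<Rightarrow> real^'n::{finite,linorder} \<Rightarrow> real^'n::{finite,linorder}" where
  "pin_rho x = (\<lambda>w. \<chi> i. (cl_mult (cl_mult (cl_grade x) (cl_vec w)) (cl_inverse x)) {i})"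

definition orth_rep :: "('g, 'b) monoid_scheme \<Rightarrow> ('g \<Rightarrow> real^'n \<Rightarrow> real^'n) \<Rightarrow> bool" where
  "orth_rep G \<pi> \<longleftrightarrow> group G \<and> finite (carrier G) \<and>
     (\<forall>g\<in>carrier G. orthogonal_transformation (\<pi> g)) \<and>
     (\<forall>g\<in>carrier G. \<forall>h\<in>carrier G. \<pi> (g \<otimes>\<^bsub>G\<^esub> h) = \<pi> g \<circ> \<pi> h)"

definition character :: "('g \<Rightarrow> real^'n \<Rightarrow> real^'n) \<Rightarrow> 'g \<Rightarrow> real" where
  "character \<pi> g = trace (matrix (\<pi> g))"

definition spinorial :: "('g, 'b) monoid_scheme \<Rightarrow> ('g \<Rightarrow> real^'n::{finite,linorder} \<Rightarrow> real^'n::{finite,linorder}) \<Rightarrow> bool" where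
  "spinorial G \<pi> \<longleftrightarrow> (\<exists>\<pi>h :: 'g \<Rightarrow> 'n::{finite,linorder} clifford.
     (\<forall>g\<in>carrier G. \<pi>h g \<in> Pin) \<and>
     (\<forall>g\<in>carrier G. \<forall>h\<in>carrier G. \<pi>h (g \<otimes>\<^bsub>G\<^esub> h) = cl_mult (\<pi>h g) (\<pi>h h)) \<and>
     (\<forall>g\<in>carrier G. pin_rho (\<pi>h g) = \<pi> g))"

definition s_transp :: "nat \<Rightarrow> nat \<Rightarrow> nat" where
  "s_transp i = Transposition.transpose i (i + 1)"

end

theory Submission
  imports Defs
begin

text \<open>
  A spinorial lift of \<open>A\<^sub>n\<close> is a section of the pulled back double cover. Every 3-cycle has a unique
  lift of order 3, and a section must use these lifts. If double transpositions lift to involutions,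
  then the lifts \<open>x\<close>, \<open>y\<close> of \<open>(a b c)\<close>, \<open>(a b d)\<close> satisfy \<open>(x y)\<^sup>2 = 1\<close>. Together with the conjugation rules
  this allows, by induction on the set of points, to bring every product of lifted 3-cycles into a
  normal form along the chain \<open>A\<^sub>1 \<le> A\<^sub>2 \<le> \<dots>\<close>, so such a product over the identity is 1 and the section
  exists. Since it is unique, conjugation with an involutive lift of a transposition preserves it,
  and it extends to \<open>S\<^sub>n\<close>.

  An orthogonal involution whose \<open>-1\<close>-eigenspace has dimension \<open>m\<close> lifts to the product of an
  orthonormal basis of that eigenspace, whose square is \<open>(-1)\<^bsup>m(m+1)/2\<^esup>\<close>, and \<open>2 m\<close> is the difference of
  the characters. For double transpositions \<open>m\<close> is even, because they are products of 3-cycles.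
\<close>

text \<open>Lifts are determined only up to sign, so an identity between permutations carries over
  to lifts only up to sign. An element of odd order has exactly one lift of the same order; this
  removes the choice for 3-cycles, and their conjugation, squaring and inversion rules follow from
  that uniqueness alone. It does not decide the sign in \<open>(a m b) (d m a) = (d b a)\<close>,
  and there the condition on double transpositions is needed. The relations x^3 = 1 and (x y)^2 = 1
  are those of Carmichael's presentation of \<open>A\<^sub>n\<close>. The presentation is not
  quoted: a coset enumeration proves directly that these relations suffice.

  The number m(m+1)/2 is even exactly when m is 0 or 3 modulo 4, and doubling gives the residues 0
  and 6 modulo 8. Lifted 3-cycles are fixed by the grade automorphism because their cube is 1, so m
  is even for a double transposition and the residue 6 disappears.

  The Clifford signs form a bicharacter on the group of subsets under symmetric difference. The
  Clifford algebra is thus a twisted group algebra, and its associativity is the cocycle identity of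
  the signs.\<close>

section \<open>Double covers of alternating and symmetric groups\<close>

(* Distinctness hypotheses on natural numbers would otherwise be split exponentially. *)
declare [[linarith_neq_limit = 0]]

section \<open>3-cycles and conjugacy of double transpositions\<close>

definition cyc3 :: "'a \<Rightarrow> 'a \<Rightarrow> 'a \<Rightarrow> 'a \<Rightarrow> 'a" where
  "cyc3 a b c = Transposition.transpose a b \<circ> Transposition.transpose b c"

lemma cyc3_apply:
  "distinct [a, b, c] \<Longrightarrow>
    cyc3 a b c x = (if x = a then b else if x = b then c else if x = c then a else x)"
  by (auto simp: cyc3_def Transposition.transpose_def)

lemma cyc3_rotate: "distinct [a, b, c] \<Longrightarrow> cyc3 b c a = cyc3 a b c"
  by (auto simp: fun_eq_iff cyc3_apply split: if_splits)

lemma cyc3_square: "distinct [a, b, c] \<Longrightarrow> cyc3 a b c \<circ> cyc3 a b c = cyc3 a c b"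
  by (auto simp: fun_eq_iff cyc3_apply split: if_splits)

lemma cyc3_inverse: "distinct [a, b, c] \<Longrightarrow> cyc3 a b c \<circ> cyc3 a c b = id"
  by (auto simp: fun_eq_iff cyc3_apply split: if_splits)

lemma cyc3_conj:
  assumes "bij g" shows "g \<circ> cyc3 a b c = cyc3 (g a) (g b) (g c) \<circ> g"
proof
  fix x
  have "g x = g y \<longleftrightarrow> x = y" for x y using assms by (metis bij_pointE)
  then show "(g \<circ> cyc3 a b c) x = (cyc3 (g a) (g b) (g c) \<circ> g) x"
    by (auto simp: cyc3_def Transposition.transpose_def)
qed

lemma cyc3_permutes: "a \<in> X \<Longrightarrow> b \<in> X \<Longrightarrow> c \<in> X \<Longrightarrow> cyc3 a b c permutes X"
  unfolding cyc3_def by (intro permutes_compose permutes_swap_id)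

lemma cyc3_even: "distinct [a, b, c] \<Longrightarrow> evenperm (cyc3 a b c)"
  unfolding cyc3_def by (simp add: evenperm_comp permutation_swap_id evenperm_swap)

lemma cyc3_in_alt:
  assumes "{a, b, c} \<subseteq> {1..n}" "distinct [a, b, c]"
  shows "cyc3 a b c \<in> carrier (alt_group n)"
  unfolding alt_group_carrier using assms by (intro conjI cyc3_permutes cyc3_even) auto

text \<open>Each transposition moves the image of the next point to its target. Earlier targets stay
  fixed because, by injectivity, neither that image nor the new target is one of them.\<close>

lemma permutes_four_points:
  assumes "{a, b, c, d} \<subseteq> X" "distinct [a, b, c, d]" "{a', b', c', d'} \<subseteq> X" "distinct [a', b', c', d']"
  obtains g where "g permutes X" "g a = a'" "g b = b'" "g c = c'" "g d = d'"
proof -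
  let ?t = "Transposition.transpose :: 'a \<Rightarrow> 'a \<Rightarrow> 'a \<Rightarrow> 'a"
  define g1 where "g1 = ?t a a'"
  define g2 where "g2 = ?t (g1 b) b' \<circ> g1"
  define g3 where "g3 = ?t (g2 c) c' \<circ> g2"
  define g4 where "g4 = ?t (g3 d) d' \<circ> g3"
  have p1: "g1 permutes X" unfolding g1_def using assms by (intro permutes_swap_id) auto
  have i1: "g1 x = g1 y \<longleftrightarrow> x = y" for x y using p1 by (metis permutes_inverses(2))
  have p2: "g2 permutes X" unfolding g2_def using assms p1
    by (intro permutes_compose permutes_swap_id) (auto simp: permutes_in_image)
  have i2: "g2 x = g2 y \<longleftrightarrow> x = y" for x y using p2 by (metis permutes_inverses(2))
  have p3: "g3 permutes X" unfolding g3_def using assms p2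
    by (intro permutes_compose permutes_swap_id) (auto simp: permutes_in_image)
  have i3: "g3 x = g3 y \<longleftrightarrow> x = y" for x y using p3 by (metis permutes_inverses(2))
  have p4: "g4 permutes X" unfolding g4_def using assms p3
    by (intro permutes_compose permutes_swap_id) (auto simp: permutes_in_image)
  have e1: "g1 a = a'" by (simp add: g1_def)
  have "g1 b \<noteq> a'" using e1 i1 assms by (metis distinct_length_2_or_more)
  then have e2: "g2 a = a'" "g2 b = b'" using e1 assms by (auto simp: g2_def Transposition.transpose_def)
  have "g2 c \<noteq> a'" "g2 c \<noteq> b'" using e2 i2 assms by (metis distinct_length_2_or_more)+
  then have e3: "g3 a = a'" "g3 b = b'" "g3 c = c'" using e2 assms by (auto simp: g3_def Transposition.transpose_def)
  have "g3 d \<noteq> a'" "g3 d \<noteq> b'" "g3 d \<noteq> c'" using e3 i3 assms by (metis distinct_length_2_or_more)+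
  then have "g4 a = a'" "g4 b = b'" "g4 c = c'" "g4 d = d'"
    using e3 assms by (auto simp: g4_def Transposition.transpose_def)
  with p4 that show thesis by blast
qed

text \<open>An odd conjugator can be made even by composing it with the transposition of 1 and 2,
  which commutes with the double transposition.\<close>

lemma double_transposition_conj:
  fixes n :: nat
  assumes "{a, b, c, d} \<subseteq> {1..n}" "distinct [a, b, c, d]" "n \<ge> 4"
  obtains g where "g \<in> carrier (alt_group n)"
    "g \<circ> (Transposition.transpose 1 2 \<circ> Transposition.transpose 3 4) =
     (Transposition.transpose a b \<circ> Transposition.transpose c d) \<circ> g"
proof -
  let ?t = "Transposition.transpose :: nat \<Rightarrow> nat \<Rightarrow> nat \<Rightarrow> nat"
  \<comment> \<open>Only the set of \<open>g 1\<close> and \<open>g 2\<close> is prescribed, so that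
    the fact covers a conjugator as well as its correction by the transposition of 1 and 2.\<close>
  have *: "g \<circ> (?t 1 2 \<circ> ?t 3 4) = (?t a b \<circ> ?t c d) \<circ> g"
    if "g permutes {1..n}" "{g 1, g 2} = {a, b}" "g 3 = c" "g 4 = d" for g
  proof
    fix x
    have i: "g x = g y \<longleftrightarrow> x = y" for x y using that(1) by (metis permutes_inverses(2))
    have aux: "g x = c \<longleftrightarrow> x = 3" "g x = d \<longleftrightarrow> x = 4" for x using that i by metis+
    have "g 1 = a \<and> g 2 = b \<or> g 1 = b \<and> g 2 = a" using that(2)
      by (simp only: doubleton_eq_iff)
    then show "(g \<circ> (?t 1 2 \<circ> ?t 3 4)) x = ((?t a b \<circ> ?t c d) \<circ> g) x"
    proof
      assume "g 1 = a \<and> g 2 = b"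
      moreover from this have "g x = a \<longleftrightarrow> x = 1" "g x = b \<longleftrightarrow> x = 2" for x using i by metis+
      ultimately show ?thesis using that(3,4) assms(2) aux
        by (auto simp: Transposition.transpose_def)
    next
      assume "g 1 = b \<and> g 2 = a"
      moreover from this have "g x = a \<longleftrightarrow> x = 2" "g x = b \<longleftrightarrow> x = 1" for x using i by metis+
      ultimately show ?thesis using that(3,4) assms(2) aux
        by (auto simp: Transposition.transpose_def)
    qed
  qed
  have "{1, 2, 3, 4} \<subseteq> {1..n}" "distinct [1, 2, 3, 4 :: nat]" using assms by auto
  from permutes_four_points[OF this assms(1,2)] obtain g where
    g: "g permutes {1..n}" "g 1 = a" "g 2 = b" "g 3 = c" "g 4 = d" by blast
  show thesis
  proof (cases "evenperm g")
    case True
    then show thesis using that[of g] *[of g] g by (auto simp: alt_group_carrier)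
  next
    case False
    have p: "?t 1 2 permutes {1..n}" using assms(3) by (intro permutes_swap_id) auto
    have e: "evenperm (g \<circ> ?t 1 2)"
      using False g(1) p by (subst evenperm_comp) (auto simp: permutation_permutes evenperm_swap)
    have "g \<circ> ?t 1 2 permutes {1..n}" using p g(1) by (rule permutes_compose)
    moreover have "{(g \<circ> ?t 1 2) 1, (g \<circ> ?t 1 2) 2} = {a, b}" "(g \<circ> ?t 1 2) 3 = c" "(g \<circ> ?t 1 2) 4 = d"
      using g by (auto simp: Transposition.transpose_def)
    ultimately show thesis using that[of "g \<circ> ?t 1 2"] * e by (auto simp: alt_group_carrier)
  qed
qed

text \<open>
  \<open>L p x\<close> reads: \<open>x\<close> is a lift of \<open>p\<close> to a central extension with kernel \<open>{1, -1}\<close>.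
  It is a relation because one \<open>x\<close> may lift several \<open>p\<close> when the representation is not faithful.
\<close>

locale alt_cover =
  fixes n :: nat and L :: "(nat \<Rightarrow> nat) \<Rightarrow> 'a::ring_1 \<Rightarrow> bool"
  assumes L_comp: "L p x \<Longrightarrow> L q y \<Longrightarrow> L (p \<circ> q) (x * y)"
    and L_id: "L id 1"
    and L_uminus: "L p x \<Longrightarrow> L p (- x)"
    and L_id_cases: "L id x \<Longrightarrow> x = 1 \<or> x = -1"
    and one_neq: "(1::'a) \<noteq> -1"
    and L_ex: "p \<in> carrier (alt_group n) \<Longrightarrow> \<exists>x. L p x"
begin

section \<open>Lifts up to sign, and the lifts of 3-cycles with cube 1\<close>

lemma L_inverse:
  assumes "L p x" "L q y" "p \<circ> q = id" "q \<circ> p = id"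
  obtains x' where "L q x'" "x * x' = 1" "x' * x = 1"
proof -
  have "x * y = 1 \<or> x * y = -1" using L_comp[OF assms(1,2)] assms(3) L_id_cases by simp
  then have "x * y = 1 \<or> x * (- y) = 1" by auto
  then obtain z where z: "z = y \<or> z = - y" "x * z = 1" by blast
  have Lz: "L q z" using z(1) assms(2) L_uminus by auto
  have "z * x = 1 \<or> z * x = -1" using L_comp[OF Lz assms(1)] assms(4) L_id_cases by simp
  \<comment> \<open>The ring may have zero divisors, so the other side needs an argument: the value
    -1 would give \<open>x = - x\<close> and, multiplied by \<open>z\<close>,
    \<open>1 = -1\<close>.\<close>
  moreover have "z * x \<noteq> -1"
  proof
    assume "z * x = -1"
    then have "x * (z * x) = - x" by simp
    then have "x = - x" using z(2) by (simp add: mult.assoc[symmetric])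
    then have "x * z = - x * z" by simp
    then have "1 = (-1::'a)" using z(2) by simp
    then show False using one_neq by simp
  qed
  ultimately show thesis using that Lz z(2) by blast
qed

lemma L_inverse_alt:
  assumes "p \<in> carrier (alt_group n)" "L p x"
  obtains x' where "L (inv' p) x'" "x * x' = 1" "x' * x = 1"
proof -
  obtain y where "L (inv' p) y" using L_ex alt_group_inv_closed assms(1) by blast
  moreover have "p \<circ> inv' p = id" "inv' p \<circ> p = id"
    using assms(1) by (auto simp: alt_group_carrier intro: permutes_inv_o)
  ultimately show thesis using L_inverse[OF assms(2)] that by blast
qed

lemma L_unique:
  assumes "p \<in> carrier (alt_group n)" "L p x" "L p y"
  shows "y = x \<or> y = - x"
proof -
  obtain x' where x': "L (inv' p) x'" "x * x' = 1" "x' * x = 1" using L_inverse_alt assms by blast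
  have "L id (x' * y)" using L_comp[OF x'(1) assms(3)] assms(1)
    by (auto simp: alt_group_carrier permutes_inv_o)
  then have "x' * y = 1 \<or> x' * y = -1" by (rule L_id_cases)
  then have "x * (x' * y) = x \<or> x * (x' * y) = - x" by auto
  then show ?thesis using x'(2) by (simp add: mult.assoc[symmetric])
qed

text \<open>The cube of a lift is 1 or -1, and negating the lift changes the sign of the
  cube.\<close>

lemma ex1_lift_cyc3:
  assumes "{a, b, c} \<subseteq> {1..n}" "distinct [a, b, c]"
  shows "\<exists>!x. L (cyc3 a b c) x \<and> x * x * x = 1"
proof -
  have m: "cyc3 a b c \<in> carrier (alt_group n)" using cyc3_in_alt assms by blast
  then obtain x where x: "L (cyc3 a b c) x" using L_ex by blast
  have "cyc3 a b c \<circ> cyc3 a b c \<circ> cyc3 a b c = id" using assms(2)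
    by (auto simp: fun_eq_iff cyc3_apply split: if_splits)
  then have "L id (x * x * x)" using L_comp[OF L_comp[OF x x] x] by simp
  then have c: "x * x * x = 1 \<or> x * x * x = -1" by (rule L_id_cases)
  have neg: "(- y) * (- y) * (- y) = - (y * y * y)" for y :: 'a by simp
  show ?thesis
  proof (rule ex_ex1I)
    show "\<exists>x. L (cyc3 a b c) x \<and> x * x * x = 1"
      using c
    proof
      assume "x * x * x = -1"
      then have "(- x) * (- x) * (- x) = 1" by simp
      then show ?thesis using L_uminus[OF x] by blast
    qed (use x in blast)
    fix y z assume "L (cyc3 a b c) y \<and> y * y * y = 1" "L (cyc3 a b c) z \<and> z * z * z = 1"
    then have "z = y \<or> z = - y" "y * y * y = 1" "z * z * z = 1" using L_unique[OF m] by blast+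
    then show "y = z" using one_neq neg[of y] by auto
  qed
qed

definition C :: "nat \<Rightarrow> nat \<Rightarrow> nat \<Rightarrow> 'a" where
  "C a b c = (THE x. L (cyc3 a b c) x \<and> x * x * x = 1)"

lemma
  assumes "{a, b, c} \<subseteq> {1..n}" "distinct [a, b, c]"
  shows L_C: "L (cyc3 a b c) (C a b c)" and C_cube: "C a b c * C a b c * C a b c = 1"
  using theI'[OF ex1_lift_cyc3[OF assms]] unfolding C_def by auto

lemma C_eqI:
  assumes "{a, b, c} \<subseteq> {1..n}" "distinct [a, b, c]" "L (cyc3 a b c) x" "x * x * x = 1"
  shows "C a b c = x"
  unfolding C_def using assms(3,4) by (intro the1_equality ex1_lift_cyc3[OF assms(1,2)]) simp

lemma C_rotate: "distinct [a, b, c] \<Longrightarrow> C b c a = C a b c"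
  by (simp add: C_def cyc3_rotate)

lemma C_square:
  assumes "{a, b, c} \<subseteq> {1..n}" "distinct [a, b, c]"
  shows "C a b c * C a b c = C a c b"
proof (rule sym, rule C_eqI)
  let ?x = "C a b c"
  show "L (cyc3 a c b) (?x * ?x)"
    using L_comp[OF L_C L_C, OF assms assms] unfolding cyc3_square[OF assms(2)] .
  have "?x * ?x * (?x * ?x) * (?x * ?x) = (?x * ?x * ?x) * (?x * ?x * ?x)"
    by (simp only: mult.assoc)
  then show "?x * ?x * (?x * ?x) * (?x * ?x) = 1" using C_cube[OF assms] by simp
qed (use assms in auto)

lemma C_inverse:
  assumes "{a, b, c} \<subseteq> {1..n}" "distinct [a, b, c]"
  shows "C a b c * C a c b = 1"
  using C_square[OF assms] C_cube[OF assms] by (metis mult.assoc)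

text \<open>A conjugate of an element with cube 1 has cube 1, so uniqueness identifies it.
  \<open>g\<close> may be odd, as conjugation by a transposition in
  \<open>gen_conj_involution\<close> requires.\<close>

lemma C_conj:
  assumes "{a, b, c} \<subseteq> {1..n}" "distinct [a, b, c]"
    and "g permutes {1..n}" "L g x" "L (inv' g) x'" "x' * x = 1"
  shows "x * C a b c * x' = C (g a) (g b) (g c)"
proof (rule sym, rule C_eqI)
  let ?c = "C a b c"
  have bij: "bij g" using assms(3) by (rule permutes_bij)
  show "{g a, g b, g c} \<subseteq> {1..n}" using assms(1) permutes_in_image[OF assms(3)] by blast
  have "g x = g y \<longleftrightarrow> x = y" for x y using bij by (metis bij_pointE)
  then show "distinct [g a, g b, g c]" using assms(2) by simp
  have "g \<circ> cyc3 a b c \<circ> inv' g = cyc3 (g a) (g b) (g c)"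
    by (simp add: cyc3_conj[OF bij] comp_assoc permutes_inv_o[OF assms(3)])
  then show "L (cyc3 (g a) (g b) (g c)) (x * ?c * x')"
    using L_comp[OF L_comp[OF assms(4) L_C[OF assms(1,2)]] assms(5)] by simp
  have "x * ?c * x' * (x * ?c * x') * (x * ?c * x') = x * ?c * (x' * x) * ?c * (x' * x) * ?c * x'"
    by (simp only: mult.assoc)
  also have "\<dots> = x * (?c * ?c * ?c) * x'" by (simp add: assms(6) mult.assoc)
  also have "\<dots> = x * x'" by (simp add: C_cube[OF assms(1,2)])
  also have "\<dots> = 1"
  proof -
    have "g \<circ> inv' g = id" by (rule permutes_inv_o[OF assms(3)])
    then have "x * x' = 1 \<or> x * x' = -1" using L_comp[OF assms(4,5)] L_id_cases by simp
    moreover have "x * x' \<noteq> -1"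
    proof
      assume "x * x' = -1"
      then have "x * x' * x = - x" by simp
      then have "x = - x" using assms(6) by (simp add: mult.assoc)
      then have "x' * x = x' * (- x)" by simp
      then have "1 = (-1::'a)" using assms(6) by simp
      then show False using one_neq by simp
    qed
    ultimately show ?thesis by blast
  qed
  finally show "x * ?c * x' * (x * ?c * x') * (x * ?c * x') = 1" .
qed

lemma C_commute:
  assumes "{a, b, c, d, e, f} \<subseteq> {1..n}" "distinct [a, b, c]" "distinct [d, e, f]"
  shows "C a b c * C d e f = C (cyc3 a b c d) (cyc3 a b c e) (cyc3 a b c f) * C a b c"
proof -
  let ?g = "cyc3 a b c" and ?x = "C a b c"
  have g: "?g \<in> carrier (alt_group n)" and Lx: "L ?g ?x"
    using assms by (auto intro!: cyc3_in_alt L_C)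
  then obtain x' where x': "L (inv' ?g) x'" "?x * x' = 1" "x' * ?x = 1"
    using L_inverse_alt by blast
  have "?x * C d e f * x' = C (?g d) (?g e) (?g f)"
    using assms g by (intro C_conj Lx x') (auto simp: alt_group_carrier)
  then have "?x * C d e f * (x' * ?x) = C (?g d) (?g e) (?g f) * ?x"
    by (simp add: mult.assoc[symmetric])
  then show ?thesis using x' by simp
qed

text \<open>The graph of the future section: the subgroup of pairs generated by the 3-cycles in
  \<open>X\<close> with their chosen lifts. It is a relation because equal permutations are not yet
  known to carry equal lifts. \<open>X\<close> varies in the later induction on the set of
  points.\<close>

inductive gen :: "nat set \<Rightarrow> (nat \<Rightarrow> nat) \<Rightarrow> 'a \<Rightarrow> bool" for X where
  gen_id: "gen X id 1"
| gen_step: "gen X p x \<Longrightarrow> {a, b, c} \<subseteq> X \<Longrightarrow> distinct [a, b, c] \<Longrightarrow>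
    gen X (p \<circ> cyc3 a b c) (x * C a b c)"

lemma gen_comp:
  assumes "gen X p x" "gen X q y" shows "gen X (p \<circ> q) (x * y)"
  using assms(2)
proof (induction rule: gen.induct)
  case gen_id
  show "gen X (p \<circ> id) (x * 1)" using assms(1) by simp
next
  case (gen_step q y a b c)
  have "gen X (p \<circ> q \<circ> cyc3 a b c) (x * y * C a b c)"
    by (rule gen.gen_step[OF gen_step.IH gen_step.hyps(2,3)])
  then show "gen X (p \<circ> (q \<circ> cyc3 a b c)) (x * (y * C a b c))"
    by (simp only: mult.assoc comp_assoc)
qed

lemma gen_permutes:
  assumes "gen X p x" shows "p permutes X"
  using assms
proof (induction rule: gen.induct)
  case gen_id
  show "id permutes X" by (rule permutes_id)
next
  case (gen_step p x a b c)
  from gen_step.hyps have "cyc3 a b c permutes X" by (intro cyc3_permutes) auto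
  then show "p \<circ> cyc3 a b c permutes X" by (rule permutes_compose[OF _ gen_step.IH])
qed

lemma gen_L:
  assumes "gen X p x" "X \<subseteq> {1..n}" shows "L p x"
  using assms(1)
proof (induction rule: gen.induct)
  case gen_id
  show "L id 1" by (rule L_id)
next
  case (gen_step p x a b c)
  show "L (p \<circ> cyc3 a b c) (x * C a b c)"
    by (rule L_comp[OF gen_step.IH], rule L_C) (use gen_step.hyps(2,3) assms(2) in auto)
qed

lemma gen_single: "{a, b, c} \<subseteq> X \<Longrightarrow> distinct [a, b, c] \<Longrightarrow> gen X (cyc3 a b c) (C a b c)"
  using gen.gen_step[OF gen.gen_id, of a b c X] by simp

text \<open>The inverse of a chosen lift is the chosen lift of the inverse 3-cycle, so inverses need
  no generators of their own.\<close>

lemma gen_inverse: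
  assumes "gen X p x" "X \<subseteq> {1..n}"
  shows "\<exists>q y. gen X q y \<and> p \<circ> q = id \<and> q \<circ> p = id \<and> x * y = 1 \<and> y * x = 1"
  using assms(1)
proof (induction rule: gen.induct)
  case gen_id
  show "\<exists>q y. gen X q y \<and> id \<circ> q = id \<and> q \<circ> id = id \<and> 1 * y = 1 \<and> y * 1 = 1"
    using gen.gen_id by force
next
  case (gen_step p x a b c)
  obtain q y where q: "gen X q y" "p \<circ> q = id" "q \<circ> p = id" "x * y = 1" "y * x = 1"
    using gen_step.IH by blast
  have abc: "{a, b, c} \<subseteq> {1..n}" "{a, c, b} \<subseteq> {1..n}" "distinct [a, c, b]"
    using gen_step.hyps(2,3) assms(2) by auto
  have i: "cyc3 a b c \<circ> cyc3 a c b = id" "cyc3 a c b \<circ> cyc3 a b c = id"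
    by (rule cyc3_inverse; (rule gen_step.hyps(3) abc(3)))+
  have j: "C a b c * C a c b = 1" "C a c b * C a b c = 1"
    by (rule C_inverse; (rule gen_step.hyps(3) abc))+
  have "gen X (cyc3 a c b) (C a c b)"
    using gen_step.hyps(2) abc(3) by (intro gen_single) auto
  then have 1: "gen X (cyc3 a c b \<circ> q) (C a c b * y)" using gen_comp q(1) by blast
  have "(p \<circ> cyc3 a b c) \<circ> (cyc3 a c b \<circ> q) = p \<circ> (cyc3 a b c \<circ> cyc3 a c b) \<circ> q"
    "(cyc3 a c b \<circ> q) \<circ> (p \<circ> cyc3 a b c) = cyc3 a c b \<circ> (q \<circ> p) \<circ> cyc3 a b c"
    by (simp_all only: comp_assoc)
  then have 2: "(p \<circ> cyc3 a b c) \<circ> (cyc3 a c b \<circ> q) = id" "(cyc3 a c b \<circ> q) \<circ> (p \<circ> cyc3 a b c) = id"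
    using i q(2,3) by simp_all
  have "(x * C a b c) * (C a c b * y) = x * (C a b c * C a c b) * y"
    "(C a c b * y) * (x * C a b c) = C a c b * (y * x) * C a b c" by (simp_all only: mult.assoc)
  then have 3: "(x * C a b c) * (C a c b * y) = 1" "(C a c b * y) * (x * C a b c) = 1"
    using j q(4,5) by simp_all
  show "\<exists>q y. gen X q y \<and> (p \<circ> cyc3 a b c) \<circ> q = id \<and> q \<circ> (p \<circ> cyc3 a b c) = id \<and>
      (x * C a b c) * y = 1 \<and> y * (x * C a b c) = 1"
    using 1 2 3 by blast
qed

lemma gen_ex:
  assumes "p \<in> carrier (alt_group n)"
  shows "\<exists>x. gen {1..n} p x"
proof -
  have three: "\<exists>x. gen {1..n} p x" if cycs: "p \<in> three_cycles n" for p
  proof -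
    obtain cs where cs: "p = cycle_of_list cs" "cycle cs" "length cs = 3" "set cs \<subseteq> {1..n}"
      using cycs by auto
    obtain a b c where abc: "cs = [a, b, c]" using stupid_lemma[OF cs(3)] by auto
    \<comment> \<open>\<open>cyc3\<close> composes its transpositions in the order of
      \<open>cycle_of_list\<close>.\<close>
    have "p = cyc3 a b c" using cs(1) by (simp add: abc cyc3_def)
    then show ?thesis using gen_single[of a b c "{1..n}"] cs(2,4) abc by auto
  qed
  have "p \<in> generate (alt_group n) (three_cycles n)"
    using assms alt_group_carrier_as_three_cycles by metis
  then show ?thesis
  proof (induction rule: generate.induct)
    case one
    show "\<exists>x. gen {1..n} \<one>\<^bsub>alt_group n\<^esub> x" unfolding alt_group_one using gen.gen_id by blast
  next
    case (incl h)
    then show ?case by (rule three)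
  next
    case (inv h)
    then obtain x where x: "gen {1..n} h x" using three by blast
    then obtain q y where q: "gen {1..n} q y" "h \<circ> q = id" "q \<circ> h = id"
      using gen_inverse by blast
    have "h \<in> carrier (alt_group n)" using inv three_cycles_incl by blast
    then have "inv\<^bsub>alt_group n\<^esub> h = inv' h" by (rule alt_group_inv_equality)
    also have "\<dots> = q" using q(2,3) inv_unique_comp by blast
    finally show "\<exists>x. gen {1..n} (inv\<^bsub>alt_group n\<^esub> h) x" using q(1) by blast
  next
    case (eng h1 h2)
    show "\<exists>x. gen {1..n} (h1 \<otimes>\<^bsub>alt_group n\<^esub> h2) x"
      unfolding alt_group_mult using eng(3,4) gen_comp by blast
  qed
qed

text \<open>Conjugation by \<open>s\<close> permutes the 3-cycles and, by \<open>C_conj\<close>,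
  their chosen lifts in the same way.\<close>

lemma gen_conj_involution:
  assumes "gen {1..n} p x" "s permutes {1..n}" "s \<circ> s = id" "L s t" "t * t = 1"
  shows "gen {1..n} (s \<circ> p \<circ> s) (t * x * t)"
  using assms(1)
proof (induction rule: gen.induct)
  case gen_id
  show "gen {1..n} (s \<circ> id \<circ> s) (t * 1 * t)" using gen.gen_id assms by (simp only: comp_id mult_1_right)
next
  case (gen_step p x a b c)
  have s: "inv' s = s" using assms(3) inv_unique_comp by blast
  have bij: "bij s" using assms(2) by (rule permutes_bij)
  have sin: "{s a, s b, s c} \<subseteq> {1..n}"
    using gen_step.hyps(2) permutes_in_image[OF assms(2)] by blast
  have "s x = s y \<longleftrightarrow> x = y" for x y using bij by (metis bij_pointE)
  then have sd: "distinct [s a, s b, s c]" using gen_step.hyps(3) by simp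
  have 1: "t * C a b c * t = C (s a) (s b) (s c)"
    by (rule C_conj) (use gen_step.hyps(2,3) assms s in simp_all)
  have 2: "s \<circ> cyc3 a b c \<circ> s = cyc3 (s a) (s b) (s c)"
    by (simp add: cyc3_conj[OF bij] comp_assoc assms(3))
  have "(s \<circ> p \<circ> s) \<circ> (s \<circ> cyc3 a b c \<circ> s) = s \<circ> p \<circ> (s \<circ> s) \<circ> cyc3 a b c \<circ> s"
    by (simp only: comp_assoc)
  then have 3: "s \<circ> (p \<circ> cyc3 a b c) \<circ> s = (s \<circ> p \<circ> s) \<circ> (s \<circ> cyc3 a b c \<circ> s)"
    by (simp add: assms(3) comp_assoc)
  have "(t * x * t) * (t * C a b c * t) = t * x * (t * t) * C a b c * t" by (simp only: mult.assoc)
  then have 4: "t * (x * C a b c) * t = (t * x * t) * (t * C a b c * t)"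
    by (simp add: assms(5) mult.assoc)
  show "gen {1..n} (s \<circ> (p \<circ> cyc3 a b c) \<circ> s) (t * (x * C a b c) * t)"
    unfolding 3 4 1 2 by (rule gen.gen_step[OF gen_step.IH sin sd])
qed

end

text \<open>One double transposition suffices, since all of them are conjugate in the alternating
  group. Its two lifts differ by a sign and have the same square.\<close>

locale split_alt_cover = alt_cover +
  assumes four: "n \<ge> 4"
    and double_transposition_square:
      "L (Transposition.transpose 1 2 \<circ> Transposition.transpose 3 4) x \<Longrightarrow> x * x = 1"
begin

lemma disjoint_transpositions_square:
  assumes "{a, b, c, d} \<subseteq> {1..n}" "distinct [a, b, c, d]"
    and "L (Transposition.transpose a b \<circ> Transposition.transpose c d) x"
  shows "x * x = 1"
proof -
  let ?s = "Transposition.transpose 1 2 \<circ> Transposition.transpose 3 (4 :: nat)"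
  let ?t = "Transposition.transpose a b \<circ> Transposition.transpose c d"
  obtain g where g: "g \<in> carrier (alt_group n)" "g \<circ> ?s = ?t \<circ> g"
    using double_transposition_conj[OF assms(1,2) four] by metis
  have gi: "inv' g \<circ> g = id" using g(1) by (auto simp: alt_group_carrier intro: permutes_inv_o)
  obtain y where y: "L g y" using L_ex g(1) by blast
  obtain y' where y': "L (inv' g) y'" "y * y' = 1" "y' * y = 1"
    using L_inverse_alt[OF g(1) y] by blast
  have "L (inv' g \<circ> ?t \<circ> g) (y' * x * y)" by (intro L_comp y y' assms)
  moreover have "inv' g \<circ> ?t \<circ> g = ?s"
  proof -
    have "inv' g \<circ> ?t \<circ> g = inv' g \<circ> (?t \<circ> g)" by (rule comp_assoc)
    also have "\<dots> = inv' g \<circ> (g \<circ> ?s)" by (simp only: g(2))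
    also have "\<dots> = (inv' g \<circ> g) \<circ> ?s" by (rule comp_assoc[symmetric])
    finally show ?thesis by (simp only: gi id_comp)
  qed
  ultimately have "y' * x * y * (y' * x * y) = 1" using double_transposition_square by simp
  moreover have "y' * x * y * (y' * x * y) = y' * (x * (y * y') * x) * y" by (simp only: mult.assoc)
  ultimately have *: "y' * (x * x) * y = 1" using y'(2) by simp
  have "x * x = (y * y') * (x * x) * (y * y')" using y'(2) by simp
  also have "\<dots> = y * (y' * (x * x) * y) * y'" by (simp only: mult.assoc)
  finally show ?thesis using * y'(2) by simp
qed

text \<open>The product lies over \<open>(a c) (b d)\<close>. The condition on double transpositions
  enters the normal form argument only here.\<close>

lemma C_mult_square:
  assumes "{a, b, c, d} \<subseteq> {1..n}" "distinct [a, b, c, d]"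
  shows "C a b c * C a b d * (C a b c * C a b d) = 1"
proof (rule disjoint_transpositions_square)
  show "L (Transposition.transpose a c \<circ> Transposition.transpose b d) (C a b c * C a b d)"
  proof -
    have "cyc3 a b c \<circ> cyc3 a b d = Transposition.transpose a c \<circ> Transposition.transpose b d"
      using assms(2) by (auto simp: fun_eq_iff cyc3_apply Transposition.transpose_def)
    then show ?thesis using L_comp[OF L_C L_C, of a b c a b d] assms by simp
  qed
qed (use assms in auto)

text \<open>The permutations agree, so the point is the sign. With \<open>x = C a m b\<close> and
  \<open>y = C a m d\<close>, conjugation by \<open>y\<close> turns \<open>C d b a\<close> into
  \<open>x * x\<close>, which equals \<open>y * x * y\<close> because (x y)^2 = 1 and x^3 = 1.
  Cancelling \<open>y\<close> leaves \<open>C d b a = x * (y * y)\<close>.\<close>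

lemma C_mult_inverse:
  assumes "{a, b, m, d} \<subseteq> {1..n}" "distinct [a, m, b, d]"
  shows "C a m b * C d m a = C d b a"
proof -
  let ?x = "C a m b" and ?y = "C a m d"
  have x3: "?x * ?x * ?x = 1" and y3: "?y * ?y * ?y = 1" using assms by (auto intro!: C_cube)
  have "C a d m = C d m a" using C_rotate[of a d m] assms by auto
  moreover have "?y * ?y = C a d m" using assms by (intro C_square) auto
  ultimately have y2: "?y * ?y = C d m a" by simp
  have x2: "?x * ?x = C a b m" using assms by (intro C_square) auto
  have "?y * C d b a = C (cyc3 a m d d) (cyc3 a m d b) (cyc3 a m d a) * ?y"
    using assms by (intro C_commute) auto
  also have "C (cyc3 a m d d) (cyc3 a m d b) (cyc3 a m d a) = ?x * ?x"
    using assms by (auto simp: cyc3_apply x2)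
  finally have 1: "?y * C d b a = ?x * ?x * ?y" .
  have sq: "?x * ?y * (?x * ?y) = 1" using assms by (intro C_mult_square) auto
  have "?y * ?x * ?y = (?x * ?x * ?x) * (?y * ?x * ?y)" using x3 by simp
  also have "\<dots> = ?x * ?x * (?x * ?y * (?x * ?y))" by (simp only: mult.assoc)
  also have "\<dots> = ?x * ?x" using sq by simp
  finally have yxy: "?y * ?x * ?y = ?x * ?x" .
  have "C d b a = (?y * ?y * ?y) * C d b a" using y3 by simp
  also have "\<dots> = ?y * ?y * (?y * C d b a)" by (simp only: mult.assoc)
  also have "\<dots> = ?y * ?y * ((?y * ?x * ?y) * ?y)" using 1 yxy by simp
  also have "\<dots> = (?y * ?y * ?y) * (?x * (?y * ?y))" by (simp only: mult.assoc)
  also have "\<dots> = ?x * C d m a" using y3 y2 by simp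
  finally show ?thesis by simp
qed

text \<open>
  The 3-cycles \<open>cyc3 a m b\<close> represent the nontrivial right cosets of the alternating group on \<open>Y\<close> in
  the one on \<open>insert m Y\<close>, with repetitions: the coset depends on \<open>a\<close> only.
\<close>

inductive coset_form :: "nat set \<Rightarrow> nat \<Rightarrow> (nat \<Rightarrow> nat) \<Rightarrow> 'a \<Rightarrow> bool" for Y m where
  trivial_coset: "gen Y p x \<Longrightarrow> coset_form Y m p x"
| cyc3_coset: "gen Y q y \<Longrightarrow> {a, b} \<subseteq> Y \<Longrightarrow> a \<noteq> b \<Longrightarrow> p = q \<circ> cyc3 a m b \<Longrightarrow> x = y * C a m b \<Longrightarrow>
    coset_form Y m p x"

lemma coset_form_left:
  assumes "coset_form Y m p x" "gen Y q y"
  shows "coset_form Y m (q \<circ> p) (y * x)"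
  using assms(1)
proof cases
  case trivial_coset
  then show ?thesis using gen_comp[OF assms(2)] coset_form.trivial_coset by blast
next
  case (cyc3_coset q' y' a b)
  show ?thesis
    by (rule coset_form.cyc3_coset[OF gen_comp[OF assms(2) cyc3_coset(1)] cyc3_coset(2,3)])
      (simp_all only: cyc3_coset(4,5) mult.assoc comp_assoc)
qed

text \<open>A 3-cycle through \<open>m\<close> can be rotated until \<open>m\<close> stands in the
  middle.\<close>

lemma coset_form_C:
  assumes "{c, d, e} \<subseteq> insert m Y" "distinct [c, d, e]"
  shows "coset_form Y m (cyc3 c d e) (C c d e)"
proof -
  have *: "coset_form Y m (cyc3 a m b) (C a m b)" if "{a, b} \<subseteq> Y" "a \<noteq> b" for a b
    by (rule coset_form.cyc3_coset[OF gen.gen_id that]) simp_all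
  have rot: "C c d e = C d e c" "C c d e = C e c d" "cyc3 c d e = cyc3 d e c" "cyc3 c d e = cyc3 e c d"
    using assms(2) C_rotate[of c d e] C_rotate[of e c d] cyc3_rotate[of c d e] cyc3_rotate[of e c d]
    by auto
  consider "{c, d, e} \<subseteq> Y" | "d = m" "{c, e} \<subseteq> Y" | "c = m" "{d, e} \<subseteq> Y" | "e = m" "{c, d} \<subseteq> Y"
    using assms by auto
  then show ?thesis
  proof cases
    case 1
    then show ?thesis using assms by (intro trivial_coset gen_single)
  next
    case 2
    then show ?thesis using * assms by auto
  next
    case 3
    then have "coset_form Y m (cyc3 e m d) (C e m d)" using assms(2) by (intro *) auto
    then show ?thesis using rot 3 by simp
  next
    case 4
    then have "coset_form Y m (cyc3 d m c) (C d m c)" using assms(2) by (intro *) auto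
    then show ?thesis using rot 4 by simp
  qed
qed

text \<open>The core of the coset enumeration: a representative times a generator is again an
  element over \<open>Y\<close> times a representative, with no sign left open.\<close>

lemma coset_form_cyc3_C:
  assumes Y: "insert m Y \<subseteq> {1..n}" "m \<notin> Y" and ab: "{a, b} \<subseteq> Y" "a \<noteq> b"
    and cde: "{c, d, e} \<subseteq> insert m Y" "distinct [c, d, e]"
  shows "coset_form Y m (cyc3 a m b \<circ> cyc3 c d e) (C a m b * C c d e)"
proof -
  have "m \<noteq> a" "m \<noteq> b" using Y ab by auto
  note m = this this[symmetric]
  \<comment> \<open>Rotation reduces a second cycle through \<open>m\<close> to this shape. The
    cases compare the neighbours of \<open>m\<close> with \<open>a\<close>.\<close>
  have middle: "coset_form Y m (cyc3 a m b \<circ> cyc3 c m d) (C a m b * C c m d)"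
    if cd: "{c, d} \<subseteq> Y" "c \<noteq> d" for c d
  proof -
    have "m \<noteq> c" "m \<noteq> d" using Y cd by auto
    note m = m this this[symmetric]
    have inY: "{a, b, c, d, m} \<subseteq> {1..n}" using Y ab cd by auto
    consider "d = a" "c = b" | "d = a" "c \<noteq> b" | "c = a" "d = b" | "c = a" "d \<noteq> b" | "a \<noteq> c" "a \<noteq> d" by blast
    then show ?thesis
    proof cases
      case 1
      have "C c m d = C a b m" "cyc3 c m d = cyc3 a b m"
        using 1 m ab C_rotate[of a b m] cyc3_rotate[of a b m] by simp_all
      moreover have "C a m b * C a b m = 1" "cyc3 a m b \<circ> cyc3 a b m = id"
        using inY m ab by (intro C_inverse cyc3_inverse; simp)+
      ultimately show ?thesis using trivial_coset[OF gen.gen_id, of Y m] by (simp only:)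
    next
      case 2
      have "C a m b * C c m a = C c b a" using 2 inY m ab cd by (intro C_mult_inverse) simp_all
      moreover have "cyc3 a m b \<circ> cyc3 c m a = cyc3 c b a"
        using 2 m ab cd by (simp add: fun_eq_iff cyc3_apply)
      moreover have "coset_form Y m (cyc3 c b a) (C c b a)" using 2 ab cd by (intro coset_form_C) auto
      ultimately show ?thesis using 2 by (simp only:)
    next
      case 3
      have "C a m b * C c m d = C b m a"
        using 3 C_square[of a m b] C_rotate[of a b m] inY m ab by simp
      moreover have "cyc3 a m b \<circ> cyc3 c m d = cyc3 b m a"
        using 3 cyc3_square[of a m b] cyc3_rotate[of a b m] inY m ab by simp
      moreover have "coset_form Y m (cyc3 b m a) (C b m a)" using m ab by (intro coset_form_C) auto
      ultimately show ?thesis by (simp only:)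
    next
      case 4
      \<comment> \<open>\<open>C_mult_inverse\<close> needs a right factor of the form
        \<open>C d m a\<close>, so \<open>C a m d\<close> is written as the square of its
        inverse.\<close>
      have "C a m d = C d m a * C d m a"
        using C_square[of d m a] C_rotate[of d a m] inY m cd 4 by simp
      then have "C a m b * C c m d = (C a m b * C d m a) * C d m a"
        using 4 by (simp add: mult.assoc)
      also have "C a m b * C d m a = C d b a" using 4 inY m ab cd by (intro C_mult_inverse) simp_all
      finally have 1: "C a m b * C c m d = C d b a * C d m a" .
      have 2: "cyc3 a m b \<circ> cyc3 c m d = cyc3 d b a \<circ> cyc3 d m a"
        using 4 m ab cd by (simp add: fun_eq_iff cyc3_apply)
      have "coset_form Y m (cyc3 d m a) (C d m a)" using 4 m ab cd by (intro coset_form_C) simp_all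
      moreover have "gen Y (cyc3 d b a) (C d b a)" using 4 m ab cd by (intro gen_single) simp_all
      ultimately show ?thesis unfolding 1 2 by (rule coset_form_left)
    next
      case 5
      \<comment> \<open>The point sent to \<open>m\<close> by \<open>?g\<close> is \<open>a\<close>,
        which is neither \<open>c\<close> nor \<open>d\<close>, and \<open>m\<close> itself is sent
        to \<open>b\<close>. Conjugation by \<open>?g\<close> therefore puts the second cycle inside
        \<open>Y\<close>, and it can stand on the left.\<close>
      let ?g = "cyc3 a m b"
      have 1: "C a m b * C c m d = C (?g c) (?g m) (?g d) * C a m b"
        using inY m ab cd by (intro C_commute) auto
      have bij: "bij ?g" by (rule permutes_bij[OF cyc3_permutes[of _ UNIV]]) auto
      have 2: "cyc3 a m b \<circ> cyc3 c m d = cyc3 (?g c) (?g m) (?g d) \<circ> cyc3 a m b"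
        by (rule cyc3_conj[OF bij])
      have g: "?g m = b" "?g c \<in> Y" "?g d \<in> Y" "?g c \<noteq> ?g d" "?g c \<noteq> b" "?g d \<noteq> b"
        using 5 m ab cd by (auto simp: cyc3_apply)
      have "coset_form Y m ?g (C a m b)" using m ab by (intro coset_form_C) simp_all
      moreover have "gen Y (cyc3 (?g c) (?g m) (?g d)) (C (?g c) (?g m) (?g d))"
        using g ab by (intro gen_single) simp_all
      ultimately show ?thesis unfolding 1 2 by (rule coset_form_left)
    qed
  qed
  have rot: "C c d e = C d e c" "C c d e = C e c d" "cyc3 c d e = cyc3 d e c" "cyc3 c d e = cyc3 e c d"
    using cde(2) C_rotate[of c d e] C_rotate[of e c d] cyc3_rotate[of c d e] cyc3_rotate[of e c d]
    by auto
  consider "{c, d, e} \<subseteq> Y" | "d = m" "{c, e} \<subseteq> Y" | "c = m" "{d, e} \<subseteq> Y" | "e = m" "{c, d} \<subseteq> Y"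
    using cde by auto
  then show ?thesis
  proof cases
    case 1
    \<comment> \<open>The second cycle fixes \<open>m\<close>. Moving it to the left replaces
      \<open>a\<close> and \<open>b\<close> by their preimages \<open>?h a\<close> and
      \<open>?h b\<close>, which stay in \<open>Y\<close>.\<close>
    let ?g = "cyc3 c d e" and ?h = "cyc3 c e d"
    have perm: "?g permutes Y" "?h permutes Y" using 1 by (auto intro!: cyc3_permutes)
    have gh: "?g (?h x) = x" for x using cyc3_inverse[OF cde(2)] by (metis comp_apply id_apply)
    have h: "{?h a, ?h b} \<subseteq> Y" "?h a \<noteq> ?h b"
    proof -
      show "{?h a, ?h b} \<subseteq> Y" using ab(1) by (simp add: permutes_in_image[OF perm(2)])
      show "?h a \<noteq> ?h b" using gh ab(2) by metis
    qed
    have gm: "?g m = m" using perm(1) Y(2) by (simp add: permutes_not_in)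
    have "C c d e * C (?h a) m (?h b) = C (?g (?h a)) (?g m) (?g (?h b)) * C c d e"
      using Y 1 h cde(2) by (intro C_commute) auto
    then have 2: "C a m b * C c d e = C c d e * C (?h a) m (?h b)" by (simp add: gh gm)
    have "bij ?g" by (rule permutes_bij[OF perm(1)])
    then have "?g \<circ> cyc3 (?h a) m (?h b) = cyc3 (?g (?h a)) (?g m) (?g (?h b)) \<circ> ?g" by (rule cyc3_conj)
    then have 3: "cyc3 a m b \<circ> cyc3 c d e = cyc3 c d e \<circ> cyc3 (?h a) m (?h b)" by (simp add: gh gm)
    show ?thesis unfolding 2 3
      by (rule coset_form_left[OF coset_form_C gen_single]) (use 1 h cde Y in auto)
  next
    case 2
    then show ?thesis using middle[of c e] cde by simp
  next
    case 3
    then show ?thesis using middle[of e d] cde rot by auto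
  next
    case 4
    then show ?thesis using middle[of d c] cde rot by auto
  qed
qed

lemma gen_coset_form:
  assumes "gen (insert m Y) p x" "insert m Y \<subseteq> {1..n}" "m \<notin> Y"
  shows "coset_form Y m p x"
  using assms(1)
proof (induction rule: gen.induct)
  case gen_id
  show "coset_form Y m id 1" by (rule trivial_coset[OF gen.gen_id])
next
  case (gen_step p x c d e)
  from gen_step.IH show "coset_form Y m (p \<circ> cyc3 c d e) (x * C c d e)"
  proof cases
    case trivial_coset
    then show ?thesis by (intro coset_form_left coset_form_C gen_step.hyps)
  next
    case (cyc3_coset q y a b)
    have "coset_form Y m (q \<circ> (cyc3 a m b \<circ> cyc3 c d e)) (y * (C a m b * C c d e))"
      using cyc3_coset assms gen_step.hyps by (intro coset_form_left coset_form_cyc3_C) auto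
    then show ?thesis by (simp only: cyc3_coset(4,5) mult.assoc comp_assoc)
  qed
qed

lemma gen_kernel: "finite X \<Longrightarrow> X \<subseteq> {1..n} \<Longrightarrow> gen X id x \<Longrightarrow> x = 1"
proof (induction X arbitrary: x rule: finite_induct)
  case empty
  from empty(2) show ?case by cases auto
next
  case (insert m Y)
  then have "coset_form Y m id x" by (intro gen_coset_form)
  then show ?case
  proof cases
    case trivial_coset
    show "x = 1" by (rule insert.IH[OF _ trivial_coset]) (use insert.prems in simp)
  next
    case (cyc3_coset q y a b)
    have "m \<noteq> a" "m \<noteq> b" using insert cyc3_coset by auto
    then have "cyc3 a m b a = m" using cyc3_coset(3) by (simp add: cyc3_apply)
    moreover have "q m = m" using gen_permutes[OF cyc3_coset(1)] insert(2) by (simp add: permutes_not_in)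
    ultimately have "a = m" using cyc3_coset(4) by (metis comp_apply id_apply)
    then show ?thesis using \<open>m \<noteq> a\<close> by simp
  qed
qed

lemma gen_unique:
  assumes "gen {1..n} p x" "gen {1..n} p x'"
  shows "x = x'"
proof -
  obtain q y where y: "gen {1..n} q y" "p \<circ> q = id" "x' * y = 1" "y * x' = 1"
    using gen_inverse[OF assms(2)] by blast
  have "gen {1..n} (p \<circ> q) (x * y)" by (rule gen_comp[OF assms(1) y(1)])
  then have "x * y = 1" unfolding y(2) by (intro gen_kernel[of "{1..n}"]) auto
  then show ?thesis using y(4) by (metis mult.assoc mult_1_left mult_1_right)
qed

section \<open>The section over the alternating group and its extension to the symmetric
  group\<close>

definition sect :: "(nat \<Rightarrow> nat) \<Rightarrow> 'a" where
  "sect p = (THE x. gen {1..n} p x)"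

lemma sect_eqI: "gen {1..n} p x \<Longrightarrow> sect p = x"
  unfolding sect_def using gen_unique by blast

lemma gen_sect: "p \<in> carrier (alt_group n) \<Longrightarrow> gen {1..n} p (sect p)"
  using gen_ex sect_eqI by metis

lemma L_sect: "p \<in> carrier (alt_group n) \<Longrightarrow> L p (sect p)"
  using gen_L gen_sect by blast

lemma sect_comp:
  "p \<in> carrier (alt_group n) \<Longrightarrow> q \<in> carrier (alt_group n) \<Longrightarrow> sect (p \<circ> q) = sect p * sect q"
  by (intro sect_eqI gen_comp gen_sect)

text \<open>\<open>s\<close> stands for an odd involution with lift \<open>t\<close>. Since an odd
  \<open>p\<close> equals \<open>(p \<circ> s) \<circ> s\<close>, multiplicativity forces these
  values.\<close>

definition sym_sect :: "(nat \<Rightarrow> nat) \<Rightarrow> 'a \<Rightarrow> (nat \<Rightarrow> nat) \<Rightarrow> 'a" where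
  "sym_sect s t p = (if evenperm p then sect p else sect (p \<circ> s) * t)"

context
  fixes s t
  assumes s: "s permutes {1..n}" "\<not> evenperm s" "s \<circ> s = id" and t: "L s t" "t * t = 1"
begin

lemma comp_s_alt: "p permutes {1..n} \<Longrightarrow> \<not> evenperm p \<Longrightarrow> p \<circ> s \<in> carrier (alt_group n)"
  using s by (auto simp: alt_group_carrier permutes_compose)
    (subst evenperm_comp, auto simp: permutation_permutes)

lemma sect_conj: "p \<in> carrier (alt_group n) \<Longrightarrow> sect (s \<circ> p \<circ> s) = t * sect p * t"
  by (intro sect_eqI gen_conj_involution gen_sect s t)

lemma L_sym_sect:
  assumes "p permutes {1..n}" shows "L p (sym_sect s t p)"
proof (cases "evenperm p")
  case True
  then show ?thesis using assms L_sect by (simp add: sym_sect_def alt_group_carrier)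
next
  case False
  have "L (p \<circ> s \<circ> s) (sect (p \<circ> s) * t)" by (intro L_comp L_sect comp_s_alt assms False t)
  then show ?thesis using False by (simp add: sym_sect_def comp_assoc s)
qed

text \<open>An odd left factor leaves \<open>t\<close> in front of a value of \<open>sect\<close>.
  It is moved past it by \<open>conj\<close>; if both factors are odd, the two \<open>t\<close>
  enclose \<open>sect (q \<circ> s)\<close> and \<open>sect_conj\<close> absorbs them.\<close>

lemma sym_sect_comp:
  assumes "p permutes {1..n}" "q permutes {1..n}"
  shows "sym_sect s t (p \<circ> q) = sym_sect s t p * sym_sect s t q"
proof -
  have ev: "evenperm (p \<circ> q) \<longleftrightarrow> evenperm p = evenperm q"
    using assms by (intro evenperm_comp) (auto simp: permutation_permutes)
  have alt: "r \<in> carrier (alt_group n)" if "r permutes {1..n}" "evenperm r" for r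
    using that by (simp add: alt_group_carrier)
  have conj: "t * sect r = sect (s \<circ> r \<circ> s) * t" if "r \<in> carrier (alt_group n)" for r
    by (simp add: sect_conj[OF that] mult.assoc t)
  have scomp: "s \<circ> (s \<circ> f) = f" for f by (simp add: comp_assoc[symmetric] s)
  have salt: "s \<circ> r \<circ> s \<in> carrier (alt_group n)" if "r \<in> carrier (alt_group n)" for r
  proof -
    have "s \<circ> r permutes {1..n}" "\<not> evenperm (s \<circ> r)" using that s
      by (auto simp: alt_group_carrier permutes_compose)
        (subst (asm) evenperm_comp, auto simp: permutation_permutes)
    then show ?thesis by (rule comp_s_alt)
  qed
  consider "evenperm p" "evenperm q" | "evenperm p" "\<not> evenperm q" | "\<not> evenperm p" "evenperm q"
    | "\<not> evenperm p" "\<not> evenperm q" by blast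
  then show ?thesis
  proof cases
    case 1
    then show ?thesis using ev assms by (simp add: sym_sect_def sect_comp alt)
  next
    case 2
    then have "sect (p \<circ> (q \<circ> s)) = sect p * sect (q \<circ> s)" by (intro sect_comp alt comp_s_alt assms)
    with 2 show ?thesis using ev by (simp add: sym_sect_def comp_assoc mult.assoc)
  next
    case 3
    have "sect (p \<circ> s \<circ> (s \<circ> q \<circ> s)) = sect (p \<circ> s) * sect (s \<circ> q \<circ> s)"
      using 3 by (intro sect_comp comp_s_alt salt alt assms)
    then have "sect (p \<circ> q \<circ> s) * t = sect (p \<circ> s) * (sect (s \<circ> q \<circ> s) * t)"
      by (simp add: comp_assoc scomp mult.assoc)
    with 3 show ?thesis using ev conj[OF alt[OF assms(2)]] by (simp add: sym_sect_def comp_assoc mult.assoc)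
  next
    case 4
    have q: "q \<circ> s \<in> carrier (alt_group n)" using 4 by (intro comp_s_alt assms)
    have "sect (p \<circ> s \<circ> (s \<circ> (q \<circ> s) \<circ> s)) = sect (p \<circ> s) * sect (s \<circ> (q \<circ> s) \<circ> s)"
      using 4 by (intro sect_comp comp_s_alt salt q assms)
    moreover have "sect (s \<circ> (q \<circ> s) \<circ> s) = t * sect (q \<circ> s) * t" by (rule sect_conj[OF q])
    ultimately have "sect (p \<circ> q) = sect (p \<circ> s) * (t * sect (q \<circ> s) * t)"
      by (simp add: comp_assoc scomp s)
    with 4 show ?thesis using ev by (simp add: sym_sect_def comp_assoc mult.assoc)
  qed
qed

end

end

declare [[linarith_neq_limit = 9]]

section \<open>The Clifford algebra as a ring\<close>

text \<open>The pairs \<open>t < s\<close> record swaps and the diagonal records e_i e_i = -1;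
  together they fill one product over pairs. This form shows that the sign is multiplicative in each
  argument under symmetric difference.\<close>

lemma cl_sign_eq_prod: "cl_sign S T = (\<Prod>s\<in>S. \<Prod>t\<in>T. if t \<le> s then -1 else 1)"
proof -
  let ?A = "{(s, t). s \<in> S \<and> t \<in> T \<and> t < s}" and ?B = "{(s, t). s \<in> S \<and> t \<in> T \<and> t = s}"
  have "?B = (\<lambda>s. (s, s)) ` (S \<inter> T)" by auto
  then have "card (S \<inter> T) = card ?B" by (simp add: card_image inj_on_def)
  then have "card ?A + card (S \<inter> T) = card (?A \<union> ?B)" by (subst card_Un_disjoint) auto
  also have "?A \<union> ?B = {p \<in> S \<times> T. snd p \<le> fst p}" by auto
  finally have "cl_sign S T = (-1) ^ card {p \<in> S \<times> T. snd p \<le> fst p}" by (simp add: cl_sign_def)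
  also have "\<dots> = (\<Prod>p\<in>S \<times> T. if snd p \<le> fst p then -1 else 1)"
    by (simp add: prod.If_cases Int_def)
  also have "\<dots> = (\<Prod>s\<in>S. \<Prod>t\<in>T. if t \<le> s then -1 else 1)"
    by (simp add: prod.cartesian_product case_prod_unfold)
  finally show ?thesis .
qed

lemma prod_sym_diff:
  fixes f :: "'a::finite \<Rightarrow> real"
  assumes "\<And>x. f x * f x = 1"
  shows "prod f (sym_diff S T) = prod f S * prod f T"
proof -
  have "prod f (S \<inter> T) * prod f (S \<inter> T) = 1" using assms by (simp add: prod.distrib[symmetric])
  moreover have "prod f S = prod f (S - T) * prod f (S \<inter> T)" "prod f T = prod f (T - S) * prod f (S \<inter> T)"
    by (subst prod.union_disjoint[symmetric]; force intro!: prod.cong)+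
  moreover have "prod f (sym_diff S T) = prod f (S - T) * prod f (T - S)"
    by (rule prod.union_disjoint) auto
  ultimately show ?thesis by (simp add: algebra_simps)
qed

lemma cl_sign_sym_diff_left: "cl_sign (sym_diff S S') T = cl_sign S T * cl_sign S' T"
  unfolding cl_sign_eq_prod
  by (rule prod_sym_diff) (simp only: prod.distrib[symmetric], rule prod.neutral, simp)

lemma cl_sign_sym_diff_right: "cl_sign S (sym_diff T T') = cl_sign S T * cl_sign S T'"
  unfolding cl_sign_eq_prod by (subst prod_sym_diff) (simp_all add: prod.distrib)

lemma cl_sign_square: "cl_sign S T * cl_sign S T = 1"
  by (simp add: cl_sign_def power_add[symmetric] mult_2[symmetric])

lemma cl_sign_empty [simp]: "cl_sign {} T = 1" "cl_sign S {} = 1"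
  by (simp_all add: cl_sign_eq_prod)

lemma cl_sign_singletons: "cl_sign {i} {j} = (if j \<le> i then -1 else 1)"
  by (simp add: cl_sign_eq_prod)

lemma minus_one_card_sym_diff:
  "(-1 :: real) ^ card (sym_diff S (T :: 'a::finite set)) = (-1) ^ card S * (-1) ^ card T"
  using prod_sym_diff[of "\<lambda>_. -1" S T] by simp

text \<open>The generator e_i anticommutes with all factors of e_S except itself, hence the exponent
  \<open>card S - 1\<close>.\<close>

lemma cl_sign_commute_singleton:
  assumes "i \<in> S" shows "cl_sign S {i} * cl_sign {i} S = - ((-1) ^ card S)"
proof -
  have "cl_sign S {i} * cl_sign {i} S = (\<Prod>s\<in>S. if s = i then 1 else -1)"
    unfolding cl_sign_eq_prod by (simp add: prod.distrib[symmetric]) (rule prod.cong, auto)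
  also have "\<dots> = (\<Prod>s\<in>S - {i}. -1)"
    using assms by (subst prod.remove[of S i]) (auto intro!: prod.cong)
  also have "\<dots> = (-1) ^ (card S - 1)" using assms by simp
  also have "\<dots> = - ((-1) ^ card S)"
    using assms by (cases "card S") auto
  finally show ?thesis .
qed

lemma sym_diff_cancel_left [simp]: "sym_diff S (sym_diff S T) = T"
  by blast

lemma sym_diff_cancel_right [simp]: "sym_diff (sym_diff S T) T = S"
  by blast

lemma cl_mult_eq: "cl_mult x y U = (\<Sum>S\<in>UNIV. cl_sign S (sym_diff S U) * x S * y (sym_diff S U))"
proof -
  have "sym_diff S T = U \<longleftrightarrow> sym_diff S U = T" for S T :: "'a set" by blast
  then show ?thesis unfolding cl_mult_def by (simp only:) (simp add: sum.delta')
qed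

text \<open>A separate type can be made an instance of \<open>real_algebra_1\<close>, which gives
  ring notation and the class \<open>ring_1\<close> that \<open>alt_cover\<close> asks for.\<close>

typedef 'n cliff = "UNIV :: ('n set \<Rightarrow> real) set" morphisms coeff Cliff by simp

lemmas coeff_Cliff [simp] = Cliff_inverse[OF UNIV_I]

lemma cliff_eqI: "(\<And>S. coeff x S = coeff y S) \<Longrightarrow> x = y"
  by (simp add: coeff_inject[symmetric] fun_eq_iff)

instantiation cliff :: ("{finite,linorder}") real_algebra_1
begin

definition "0 = Cliff (\<lambda>S. 0)"
definition "1 = Cliff cl_one"
definition "x + y = Cliff (\<lambda>S. coeff x S + coeff y S)"
definition "- x = Cliff (\<lambda>S. - coeff x S)" for x :: "'a cliff"
definition "x - y = Cliff (\<lambda>S. coeff x S - coeff y S)"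
definition "c *\<^sub>R x = Cliff (\<lambda>S. c * coeff x S)"
definition "x * y = Cliff (cl_mult (coeff x) (coeff y))"

lemma coeff_simps [simp]:
  "coeff (0 :: 'a cliff) S = 0" "coeff (x + y) S = coeff x S + coeff y S" "coeff (- x) S = - coeff x S"
  "coeff (x - y) S = coeff x S - coeff y S" "coeff (c *\<^sub>R x) S = c * coeff x S"
  for x y :: "'a cliff"
  by (simp_all add: zero_cliff_def plus_cliff_def uminus_cliff_def minus_cliff_def scaleR_cliff_def)

lemma coeff_one: "coeff (1 :: 'a cliff) = cl_one"
  by (simp add: one_cliff_def)

lemma coeff_mult: "coeff (x * y) = cl_mult (coeff x) (coeff y)" for x y :: "'a cliff"
  by (simp add: times_cliff_def)

lemma coeff_mult_apply:
  "coeff (x * y) U = (\<Sum>S\<in>UNIV. cl_sign S (sym_diff S U) * coeff x S * coeff y (sym_diff S U))"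
  for x y :: "'a cliff"
  by (simp add: coeff_mult cl_mult_eq)

instance
proof
  fix x y z :: "'a cliff" and a b :: real
  show "x * y * z = x * (y * z)"
  proof (rule cliff_eqI)
    fix U
    \<comment> \<open>The 2-cocycle identity: after expansion the two sides differ by the square of
      \<open>cl_sign T U\<close>.\<close>
    have sign: "cl_sign S (sym_diff S U) * cl_sign T (sym_diff T S) =
        cl_sign T (sym_diff T U) * cl_sign (sym_diff T S) (sym_diff S U)" for S T :: "'a set"
      by (simp add: cl_sign_sym_diff_left cl_sign_sym_diff_right)
        (use cl_sign_square[of T U] in \<open>simp add: algebra_simps\<close>)
    have "coeff (x * y * z) U = (\<Sum>S\<in>UNIV. \<Sum>T\<in>UNIV. cl_sign S (sym_diff S U) * cl_sign T (sym_diff T S) *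
        coeff x T * coeff y (sym_diff T S) * coeff z (sym_diff S U))"
      by (simp add: coeff_mult_apply sum_distrib_left sum_distrib_right mult_ac)
    also have "\<dots> = (\<Sum>T\<in>UNIV. \<Sum>S\<in>UNIV. cl_sign T (sym_diff T U) * cl_sign (sym_diff T S) (sym_diff S U) *
        coeff x T * coeff y (sym_diff T S) * coeff z (sym_diff S U))"
      unfolding sign by (rule sum.swap)
    also have "\<dots> = (\<Sum>T\<in>UNIV. \<Sum>S\<in>UNIV. cl_sign T (sym_diff T U) * cl_sign S (sym_diff S (sym_diff T U)) *
        coeff x T * coeff y S * coeff z (sym_diff S (sym_diff T U)))"
    proof (rule sum.cong[OF refl])
      fix T :: "'a set"
      have "sym_diff (sym_diff T S) (sym_diff T U) = sym_diff S U" for S :: "'a set" by blast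
      then show "(\<Sum>S\<in>UNIV. cl_sign T (sym_diff T U) * cl_sign (sym_diff T S) (sym_diff S U) *
          coeff x T * coeff y (sym_diff T S) * coeff z (sym_diff S U)) =
        (\<Sum>S\<in>UNIV. cl_sign T (sym_diff T U) * cl_sign S (sym_diff S (sym_diff T U)) *
          coeff x T * coeff y S * coeff z (sym_diff S (sym_diff T U)))"
        by (intro sum.reindex_bij_witness[of _ "sym_diff T" "sym_diff T"]) (auto simp only: sym_diff_cancel_left UNIV_I)
    qed
    also have "\<dots> = coeff (x * (y * z)) U"
      by (simp add: coeff_mult_apply sum_distrib_left sum_distrib_right mult_ac)
    finally show "coeff (x * y * z) U = coeff (x * (y * z)) U" .
  qed
  have delta: "(\<Sum>S\<in>UNIV. g S * (if S = {} then 1 else 0) * h S) = g {} * h {}" for g h :: "'a set \<Rightarrow> real"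
    by (simp add: if_distrib if_distribR sum.delta cong: if_cong)
  show "1 * x = x"
    by (rule cliff_eqI) (simp add: coeff_mult_apply coeff_one cl_one_def delta)
  show "x * 1 = x"
  proof (rule cliff_eqI)
    fix U :: "'a set"
    have "sym_diff S U = {} \<longleftrightarrow> S = U" for S by blast
    then have "coeff (x * 1) U = (\<Sum>S\<in>UNIV. if S = U then cl_sign S (sym_diff S U) * coeff x S else 0)"
      unfolding coeff_mult_apply coeff_one cl_one_def by (intro sum.cong) simp_all
    also have "\<dots> = coeff x U" by (simp add: sum.delta')
    finally show "coeff (x * 1) U = coeff x U" .
  qed
  show "(0 :: 'a cliff) \<noteq> 1"
  proof
    assume "(0 :: 'a cliff) = 1"
    then have "coeff (0 :: 'a cliff) {} = coeff (1 :: 'a cliff) {}" by simp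
    then show False by (simp add: coeff_one cl_one_def)
  qed
qed (rule cliff_eqI, simp add: coeff_mult_apply sum.distrib sum_distrib_left algebra_simps)+

end

definition basis_blade :: "'n::{finite,linorder} set \<Rightarrow> 'n cliff" where
  "basis_blade S = Cliff (\<lambda>T. if T = S then 1 else 0)"

lemma coeff_basis_blade: "coeff (basis_blade S) T = (if T = S then 1 else 0)"
  by (simp add: basis_blade_def)

lemma coeff_mult_basis_blade: "coeff (x * basis_blade T) U = cl_sign (sym_diff U T) T * coeff x (sym_diff U T)"
proof -
  have "sym_diff S U = T \<longleftrightarrow> S = sym_diff U T" for S by blast
  then have "coeff (x * basis_blade T) U =
      (\<Sum>S\<in>UNIV. if S = sym_diff U T then cl_sign S (sym_diff S U) * coeff x S else 0)"
    unfolding coeff_mult_apply coeff_basis_blade by (intro sum.cong) simp_all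
  also have "\<dots> = cl_sign (sym_diff U T) (sym_diff (sym_diff U T) U) * coeff x (sym_diff U T)"
    by (simp only: sum.delta finite UNIV_I if_True)
  also have "sym_diff (sym_diff U T) U = T" by blast
  finally show ?thesis .
qed

lemma coeff_basis_blade_mult: "coeff (basis_blade T * x) U = cl_sign T (sym_diff T U) * coeff x (sym_diff T U)"
proof -
  have "coeff (basis_blade T * x) U =
      (\<Sum>S\<in>UNIV. if S = T then cl_sign S (sym_diff S U) * coeff x (sym_diff S U) else 0)"
    unfolding coeff_mult_apply coeff_basis_blade by (intro sum.cong) simp_all
  then show ?thesis by (simp only: sum.delta finite UNIV_I if_True)
qed

lemma basis_blade_mult: "basis_blade S * basis_blade T = cl_sign S T *\<^sub>R basis_blade (sym_diff S T)"
proof (rule cliff_eqI)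
  fix U
  have "sym_diff U T = S \<longleftrightarrow> U = sym_diff S T" by blast
  then show "coeff (basis_blade S * basis_blade T) U = coeff (cl_sign S T *\<^sub>R basis_blade (sym_diff S T)) U"
    unfolding coeff_mult_basis_blade coeff_simps coeff_basis_blade by simp
qed

lemma basis_blade_empty: "basis_blade {} = 1"
  by (rule cliff_eqI) (simp add: coeff_basis_blade coeff_one cl_one_def)

definition vec_cliff :: "real^'n::{finite,linorder} \<Rightarrow> 'n cliff" where
  "vec_cliff v = Cliff (cl_vec v)"

lemma coeff_vec_cliff: "coeff (vec_cliff v) = cl_vec v"
  by (simp add: vec_cliff_def)

lemma coeff_vec_cliff_singleton: "coeff (vec_cliff v) {i} = v $ i"
  by (auto simp: coeff_vec_cliff cl_vec_def)

lemma linear_vec_cliff: "linear vec_cliff"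
  by (rule linearI; rule cliff_eqI) (auto simp: coeff_vec_cliff cl_vec_def)

lemma vec_cliff_axis: "vec_cliff (axis i 1) = basis_blade {i}"
  by (rule cliff_eqI) (auto simp: coeff_vec_cliff cl_vec_def coeff_basis_blade axis_def)

lemma vec_cliff_eq_sum: "vec_cliff v = (\<Sum>i\<in>UNIV. (v $ i) *\<^sub>R basis_blade {i})"
proof -
  have "vec_cliff v = vec_cliff (\<Sum>i\<in>UNIV. (v $ i) *\<^sub>R axis i 1)"
    by (simp add: basis_expansion scalar_mult_eq_scaleR[symmetric])
  then show ?thesis by (simp add: linear_sum[OF linear_vec_cliff] linear_scale[OF linear_vec_cliff] vec_cliff_axis)
qed

lemma vec_cliff_anticommute:
  "vec_cliff v * vec_cliff w + vec_cliff w * vec_cliff v = (- 2 * (v \<bullet> w)) *\<^sub>R 1"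
proof -
  let ?e = "\<lambda>i. basis_blade {i} :: 'a cliff"
  have blade: "?e i * ?e j + ?e j * ?e i = (if i = j then - 2 else 0) *\<^sub>R 1" for i j
  proof (cases "i = j")
    case True
    then show ?thesis
      by (simp add: basis_blade_mult cl_sign_singletons basis_blade_empty scaleR_2)
  next
    case False
    moreover have "sym_diff {i} {j} = sym_diff {j} {i}" by blast
    ultimately show ?thesis by (auto simp: basis_blade_mult cl_sign_singletons)
  qed
  have "vec_cliff v * vec_cliff w + vec_cliff w * vec_cliff v =
      (\<Sum>i\<in>UNIV. \<Sum>j\<in>UNIV. (v $ i * w $ j) *\<^sub>R (?e i * ?e j)) +
      (\<Sum>j\<in>UNIV. \<Sum>i\<in>UNIV. (v $ i * w $ j) *\<^sub>R (?e j * ?e i))"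
    by (simp add: vec_cliff_eq_sum sum_product mult.commute)
  also have "(\<Sum>j\<in>UNIV. \<Sum>i\<in>UNIV. (v $ i * w $ j) *\<^sub>R (?e j * ?e i)) =
      (\<Sum>i\<in>UNIV. \<Sum>j\<in>UNIV. (v $ i * w $ j) *\<^sub>R (?e j * ?e i))" by (rule sum.swap)
  also have "(\<Sum>i\<in>UNIV. \<Sum>j\<in>UNIV. (v $ i * w $ j) *\<^sub>R (?e i * ?e j)) +
      (\<Sum>i\<in>UNIV. \<Sum>j\<in>UNIV. (v $ i * w $ j) *\<^sub>R (?e j * ?e i)) =
      (\<Sum>i\<in>UNIV. \<Sum>j\<in>UNIV. (v $ i * w $ j) *\<^sub>R (?e i * ?e j + ?e j * ?e i))"
    by (simp add: sum.distrib scaleR_right_distrib)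
  also have "\<dots> = (\<Sum>i\<in>UNIV. \<Sum>j\<in>UNIV. if i = j then (- 2 * (v $ i * w $ i)) *\<^sub>R 1 else 0)"
    unfolding blade by (intro sum.cong) auto
  also have "\<dots> = (- 2 * (v \<bullet> w)) *\<^sub>R 1"
    by (simp add: inner_vec_def scaleR_left.sum sum_distrib_left sum_negf)
  finally show ?thesis .
qed

lemma vec_cliff_square: "vec_cliff v * vec_cliff v = - ((norm v)\<^sup>2 *\<^sub>R 1)"
proof -
  have "2 *\<^sub>R (vec_cliff v * vec_cliff v) = 2 *\<^sub>R (- ((norm v)\<^sup>2 *\<^sub>R 1))"
    using vec_cliff_anticommute[of v v] by (simp add: scaleR_2 power2_norm_eq_inner flip: scaleR_minus_left scaleR_add_left)
  then show ?thesis by (simp only: scaleR_cancel_left) simp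
qed

text \<open>Clifford conjugation, the anti-automorphism with v mapped to -v. For k =
  \<open>card S\<close> the sign is (-1)^(k(k+1)/2): k(k-1)/2 from reversing the factors and k from
  negating them. It gives the inverses in the Pin group.\<close>

definition adj :: "'n::{finite,linorder} cliff \<Rightarrow> 'n cliff" where
  "adj x = Cliff (\<lambda>S. cl_sign S S * coeff x S)"

lemma adj_mult: "adj (x * y) = adj y * adj x"
proof (rule cliff_eqI)
  fix U :: "'a set"
  have sign: "cl_sign U U * cl_sign S (sym_diff S U) =
      cl_sign (sym_diff S U) S * cl_sign (sym_diff S U) (sym_diff S U) * cl_sign S S" for S
  proof -
    have "cl_sign (sym_diff S U) S * cl_sign (sym_diff S U) (sym_diff S U) * cl_sign S S =
        cl_sign U U * cl_sign S S * cl_sign S U * (cl_sign U S * cl_sign U S) * (cl_sign S S * cl_sign S S)"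
      by (simp only: cl_sign_sym_diff_left cl_sign_sym_diff_right mult_ac)
    also have "\<dots> = cl_sign U U * (cl_sign S S * cl_sign S U)"
      by (simp only: cl_sign_square mult_1_right mult.assoc)
    also have "cl_sign S S * cl_sign S U = cl_sign S (sym_diff S U)"
      by (rule cl_sign_sym_diff_right[symmetric])
    finally show ?thesis by (rule sym)
  qed
  have "coeff (adj (x * y)) U =
      (\<Sum>S\<in>UNIV. (cl_sign U U * cl_sign S (sym_diff S U)) * coeff x S * coeff y (sym_diff S U))"
    by (simp add: adj_def coeff_mult_apply sum_distrib_left mult_ac)
  also have "\<dots> = (\<Sum>S\<in>UNIV. cl_sign (sym_diff S U) S * (cl_sign (sym_diff S U) (sym_diff S U) *
      coeff y (sym_diff S U)) * (cl_sign S S * coeff x S))"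
    unfolding sign by (simp add: mult_ac)
  also have "\<dots> = (\<Sum>S\<in>UNIV. cl_sign S (sym_diff S U) * (cl_sign S S * coeff y S) *
      (cl_sign (sym_diff S U) (sym_diff S U) * coeff x (sym_diff S U)))"
    by (intro sum.reindex_bij_witness[of _ "\<lambda>S. sym_diff S U" "\<lambda>S. sym_diff S U"])
      (simp_all only: sym_diff_cancel_right UNIV_I)
  also have "\<dots> = coeff (adj y * adj x) U" by (simp add: adj_def coeff_mult_apply)
  finally show "coeff (adj (x * y)) U = coeff (adj y * adj x) U" .
qed

lemma adj_one: "adj 1 = 1"
  by (rule cliff_eqI) (simp add: adj_def coeff_one cl_one_def)

lemma adj_vec_cliff: "adj (vec_cliff v) = - vec_cliff v"
  by (rule cliff_eqI) (auto simp: adj_def coeff_vec_cliff cl_vec_def cl_sign_singletons)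

definition grade :: "'n::{finite,linorder} cliff \<Rightarrow> 'n cliff" where
  "grade x = Cliff (cl_grade (coeff x))"

lemma coeff_grade: "coeff (grade x) S = (-1) ^ card S * coeff x S"
  by (simp add: grade_def cl_grade_def)

lemma grade_mult: "grade (x * y) = grade x * grade y"
proof (rule cliff_eqI)
  fix U :: "'a set"
  have "(-1 :: real) ^ card U = (-1) ^ card S * (-1) ^ card (sym_diff S U)" for S
    using minus_one_card_sym_diff[of S "sym_diff S U"] by simp
  then have "coeff (grade (x * y)) U = (\<Sum>S\<in>UNIV. ((-1) ^ card S * (-1) ^ card (sym_diff S U)) *
      (cl_sign S (sym_diff S U) * coeff x S * coeff y (sym_diff S U)))"
    unfolding coeff_grade coeff_mult_apply sum_distrib_left by simp
  then show "coeff (grade (x * y)) U = coeff (grade x * grade y) U"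
    unfolding coeff_mult_apply coeff_grade by (simp add: mult_ac)
qed

lemma grade_one: "grade 1 = 1"
  by (rule cliff_eqI) (simp add: coeff_grade coeff_one cl_one_def)

lemma grade_minus: "grade (- x) = - grade x"
  by (rule cliff_eqI) (simp add: coeff_grade)

lemma grade_vec_cliff: "grade (vec_cliff v) = - vec_cliff v"
  by (rule cliff_eqI) (auto simp: coeff_grade coeff_vec_cliff cl_vec_def)

section \<open>Products of unit vectors and products of reflections\<close>

definition vec_prod :: "(real^'n::{finite,linorder}) list \<Rightarrow> 'n cliff" where
  "vec_prod vs = prod_list (map vec_cliff vs)"

abbreviation unit_vectors :: "(real^'n) list \<Rightarrow> bool" where
  "unit_vectors vs \<equiv> \<forall>v\<in>set vs. norm v = 1"

definition reflection :: "'a::real_inner \<Rightarrow> 'a \<Rightarrow> 'a" where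
  "reflection v w = w - (2 * (v \<bullet> w)) *\<^sub>R v"

definition reflections :: "'a::real_inner list \<Rightarrow> 'a \<Rightarrow> 'a" where
  "reflections vs = foldr reflection vs"

lemma vec_prod_simps [simp]:
  "vec_prod [] = 1" "vec_prod (v # vs) = vec_cliff v * vec_prod vs"
  "vec_prod (vs @ ws) = vec_prod vs * vec_prod ws"
  by (simp_all add: vec_prod_def)

lemma reflections_simps [simp]:
  "reflections [] w = w" "reflections (v # vs) w = reflection v (reflections vs w)"
  "reflections (vs @ ws) w = reflections vs (reflections ws w)"
  by (simp_all add: reflections_def)

lemma linear_reflection: "linear (reflection v)"
  unfolding reflection_def by (rule linearI) (simp_all add: algebra_simps)

lemma linear_reflections: "linear (reflections vs)"
proof (induction vs)
  case Nil
  have "reflections [] = (id :: 'a \<Rightarrow> 'a)" by (simp add: fun_eq_iff)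
  then show "linear (reflections [] :: 'a \<Rightarrow> 'a)" by (simp only: linear_id)
next
  case (Cons v vs)
  have "reflections (v # vs) = reflection v \<circ> reflections vs" by (simp add: fun_eq_iff)
  then show "linear (reflections (v # vs))" by (simp only: linear_compose[OF Cons linear_reflection])
qed

lemma reflection_involution: "norm v = 1 \<Longrightarrow> reflection v (reflection v w) = w"
  by (simp add: reflection_def norm_eq_1 algebra_simps)

lemma coeff_vec_prod: "coeff (vec_prod vs) = foldr cl_mult (map cl_vec vs) cl_one"
  by (induction vs) (simp_all add: coeff_one coeff_mult coeff_vec_cliff)

lemma coeff_in_Pin_iff: "coeff x \<in> Pin \<longleftrightarrow> (\<exists>vs. unit_vectors vs \<and> x = vec_prod vs)"
  by (auto simp: Pin_def coeff_vec_prod[symmetric] coeff_inject)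

lemma adj_inverse:
  assumes "unit_vectors vs"
  shows "vec_prod vs * adj (vec_prod vs) = 1" "adj (vec_prod vs) * vec_prod vs = 1"
proof -
  have "vec_prod vs * adj (vec_prod vs) = 1 \<and> adj (vec_prod vs) * vec_prod vs = 1"
    using assms
  proof (induction vs)
    case Nil
    then show ?case by (simp add: adj_one)
  next
    case (Cons v vs)
    let ?x = "vec_prod vs" and ?v = "vec_cliff v"
    have v: "?v * ?v = -1" using Cons.prems by (simp add: vec_cliff_square)
    have "?v * ?x * (adj ?x * - ?v) = - (?v * (?x * adj ?x) * ?v)" by (simp add: mult.assoc)
    moreover have "adj ?x * - ?v * (?v * ?x) = - (adj ?x * (?v * ?v) * ?x)" by (simp add: mult.assoc)
    ultimately show ?case using Cons v by (simp add: adj_mult adj_vec_cliff)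
  qed
  then show "vec_prod vs * adj (vec_prod vs) = 1" "adj (vec_prod vs) * vec_prod vs = 1" by auto
qed

text \<open>Two-sided inverses are unique, so the choice in \<open>cl_inverse\<close> can only be
  the Clifford conjugate.\<close>

lemma cl_inverse_vec_prod:
  assumes "unit_vectors vs"
  shows "cl_inverse (coeff (vec_prod vs)) = coeff (adj (vec_prod vs))"
  unfolding cl_inverse_def
proof (rule some_equality)
  let ?x = "vec_prod vs"
  show "cl_mult (coeff ?x) (coeff (adj ?x)) = cl_one \<and> cl_mult (coeff (adj ?x)) (coeff ?x) = cl_one"
    using adj_inverse[OF assms] by (simp flip: coeff_one coeff_mult)
  fix y assume "cl_mult (coeff ?x) y = cl_one \<and> cl_mult y (coeff ?x) = cl_one"
  then have "coeff (Cliff y * ?x) = coeff 1" by (simp add: coeff_one coeff_mult)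
  then have y: "Cliff y * ?x = 1" by (simp only: coeff_inject)
  have "Cliff y = Cliff y * (?x * adj ?x)" using adj_inverse[OF assms] by simp
  also have "\<dots> = adj ?x" using y by (simp add: mult.assoc[symmetric])
  finally have "coeff (Cliff y) = coeff (adj ?x)" by simp
  then show "y = coeff (adj ?x)" by simp
qed

text \<open>For one vector the signs from \<open>grade\<close> and \<open>adj\<close> cancel, and v
  u v = u - 2 (v . u) v by anticommutation and v v = -1.\<close>

lemma twisted_adjoint:
  assumes "unit_vectors vs"
  shows "grade (vec_prod vs) * vec_cliff w * adj (vec_prod vs) = vec_cliff (reflections vs w)"
  using assms
proof (induction vs)
  case Nil
  then show ?case by (simp add: grade_one adj_one)
next
  case (Cons v vs)
  let ?u = "reflections vs w" and ?x = "vec_prod vs"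
  have "grade (vec_prod (v # vs)) * vec_cliff w * adj (vec_prod (v # vs)) =
      vec_cliff v * (grade ?x * vec_cliff w * adj ?x) * vec_cliff v"
    by (simp add: grade_mult grade_vec_cliff adj_mult adj_vec_cliff mult.assoc)
  also have "\<dots> = vec_cliff v * (vec_cliff ?u * vec_cliff v)" using Cons by (simp add: mult.assoc)
  also have "vec_cliff ?u * vec_cliff v = (- 2 * (v \<bullet> ?u)) *\<^sub>R 1 - vec_cliff v * vec_cliff ?u"
    using vec_cliff_anticommute[of v ?u] by (simp add: algebra_simps)
  also have "vec_cliff v * \<dots> = (- 2 * (v \<bullet> ?u)) *\<^sub>R vec_cliff v - (vec_cliff v * vec_cliff v) * vec_cliff ?u"
    by (simp add: right_diff_distrib mult.assoc)
  also have "vec_cliff v * vec_cliff v = -1" using Cons.prems by (simp add: vec_cliff_square)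
  also have "(- 2 * (v \<bullet> ?u)) *\<^sub>R vec_cliff v - -1 * vec_cliff ?u = vec_cliff (reflection v ?u)"
    by (simp add: reflection_def linear_diff[OF linear_vec_cliff] linear_scale[OF linear_vec_cliff])
  finally show ?case by simp
qed

lemma pin_rho_vec_prod:
  assumes "unit_vectors vs" shows "pin_rho (coeff (vec_prod vs)) = reflections vs"
proof
  fix w
  have "cl_grade (coeff (vec_prod vs)) = coeff (grade (vec_prod vs))" by (simp add: grade_def)
  then have "cl_mult (cl_mult (cl_grade (coeff (vec_prod vs))) (cl_vec w)) (cl_inverse (coeff (vec_prod vs))) =
      cl_vec (reflections vs w)"
    using twisted_adjoint[OF assms, of w]
    by (simp add: cl_inverse_vec_prod[OF assms] flip: coeff_mult coeff_vec_cliff)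
  then show "pin_rho (coeff (vec_prod vs)) w = reflections vs w"
    by (simp add: pin_rho_def vec_eq_iff coeff_vec_cliff_singleton flip: coeff_vec_cliff)
qed

text \<open>Acting trivially means that \<open>grade ?x * e_i = e_i * ?x\<close> for all i. This
  equates the coefficient at any blade containing i with its negative, so \<open>?x\<close> is a
  scalar; \<open>adj\<close> fixes scalars, hence its square is 1. Without the twist by
  \<open>grade\<close> the top blade would survive in odd dimension.\<close>

lemma pin_rho_kernel:
  fixes vs :: "(real^'n::{finite,linorder}) list"
  assumes "unit_vectors vs" "\<And>w. reflections vs w = w"
  shows "vec_prod vs = 1 \<or> vec_prod vs = -1"
proof -
  let ?x = "vec_prod vs"
  have comm: "grade ?x * basis_blade {i} = basis_blade {i} * ?x" for i
  proof -
    have "grade ?x * vec_cliff (axis i 1) * adj ?x * ?x = vec_cliff (axis i 1) * ?x"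
      using twisted_adjoint[OF assms(1)] assms(2) by simp
    then show ?thesis using adj_inverse[OF assms(1)] by (simp add: mult.assoc vec_cliff_axis)
  qed
  have zero: "coeff ?x S = 0" if "i \<in> S" for S i
  proof -
    have sd: "sym_diff (sym_diff S {i}) {i} = S" "sym_diff {i} (sym_diff S {i}) = S" by auto
    have "coeff (grade ?x * basis_blade {i}) (sym_diff S {i}) = coeff (basis_blade {i} * ?x) (sym_diff S {i})"
      by (simp only: comm)
    then have "cl_sign S {i} * ((-1) ^ card S * coeff ?x S) = cl_sign {i} S * coeff ?x S"
      by (simp only: coeff_mult_basis_blade coeff_basis_blade_mult sd coeff_grade)
    then have "cl_sign {i} S * (cl_sign S {i} * ((-1) ^ card S * coeff ?x S)) =
        cl_sign {i} S * cl_sign {i} S * coeff ?x S" by (simp only: mult.assoc)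
    moreover have "cl_sign {i} S * (cl_sign S {i} * ((-1) ^ card S * coeff ?x S)) =
        (cl_sign S {i} * cl_sign {i} S) * (-1) ^ card S * coeff ?x S" by (simp only: mult_ac)
    ultimately show ?thesis
      by (simp add: cl_sign_commute_singleton[OF that] cl_sign_square power_add[symmetric] mult_2[symmetric])
  qed
  define c where "c = coeff ?x {}"
  have x: "?x = c *\<^sub>R 1"
  proof (rule cliff_eqI)
    fix S show "coeff ?x S = coeff (c *\<^sub>R 1) S"
      using zero by (cases "S = {}") (auto simp: c_def coeff_one cl_one_def)
  qed
  have "adj ?x = ?x" unfolding x
    by (rule cliff_eqI) (simp add: adj_def coeff_one cl_one_def)
  then have "?x * ?x = 1" using adj_inverse[OF assms(1)] by simp
  then have "coeff ((c * c) *\<^sub>R (1 :: 'n cliff)) {} = coeff (1 :: 'n cliff) {}" by (simp add: x)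
  then have "c * c = 1" by (simp add: coeff_one cl_one_def)
  then have "c = 1 \<or> c = -1" by (simp add: square_eq_1_iff)
  then show ?thesis using x by auto
qed

section \<open>Orthogonal maps as products of reflections\<close>

lemma orthogonal_transformation_reflections:
  fixes vs :: "'a::euclidean_space list"
  assumes "\<forall>v\<in>set vs. norm v = 1"
  shows "orthogonal_transformation (reflections vs)"
  using assms
proof (induction vs)
  case Nil
  have "reflections [] = (id :: 'a \<Rightarrow> 'a)" by (simp add: fun_eq_iff)
  then show "orthogonal_transformation (reflections [] :: 'a \<Rightarrow> 'a)"
    using orthogonal_transformation_id by (simp only: id_def)
next
  case (Cons v vs)
  have "orthogonal_transformation (reflection v)"
    using Cons.prems linear_reflection
    by (auto simp: orthogonal_transformation_def reflection_def norm_eq_1 inner_diff inner_commute algebra_simps)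
  moreover have "orthogonal_transformation (reflections vs)" using Cons by simp
  moreover have "reflections (v # vs) = reflection v \<circ> reflections vs" by (simp add: fun_eq_iff)
  ultimately show "orthogonal_transformation (reflections (v # vs))"
    by (simp only: orthogonal_transformation_compose)
qed

text \<open>Cartan--Dieudonne: reflecting in \<open>f w - w\<close> enlarges the space of fixed vectors.\<close>

lemma orthogonal_transformation_eq_reflections:
  fixes f :: "'a::euclidean_space \<Rightarrow> 'a"
  assumes "orthogonal_transformation f"
  obtains vs where "\<forall>v\<in>set vs. norm v = 1" "reflections vs = f"
proof -
  have "\<exists>vs. (\<forall>v\<in>set vs. norm v = 1) \<and> reflections vs = f"
    using assms
  proof (induction "DIM('a) - dim {w. f w = w}" arbitrary: f rule: less_induct)
    case less
    have lin: "linear f" and inner: "\<And>x y. f x \<bullet> f y = x \<bullet> y"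
      using less.prems by (auto simp: orthogonal_transformation_def)
    show ?case
    proof (cases "\<forall>w. f w = w")
      case True
      then show ?thesis by (intro exI[of _ "[]"]) (auto simp: fun_eq_iff)
    next
      case False
      then obtain w where w: "f w \<noteq> w" by blast
      define v where "v = (1 / norm (f w - w)) *\<^sub>R (f w - w)"
      have nv: "norm v = 1" using w by (simp add: v_def)
      define g where "g = reflection v \<circ> f"
      have og: "orthogonal_transformation g"
        using orthogonal_transformation_reflections[of "[v]"] nv less.prems
        unfolding g_def by (intro orthogonal_transformation_compose) (simp_all add: reflections_def)
      have fixf: "g u = u" if "f u = u" for u
      proof -
        have "(f w - w) \<bullet> u = f w \<bullet> f u - w \<bullet> u" using that by (simp add: inner_diff_left)
        then have "v \<bullet> u = 0" using inner by (simp add: v_def)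
        then show ?thesis using that by (simp add: g_def reflection_def)
      qed
      have fixw: "g w = w"
      proof -
        let ?d = "f w - w"
        \<comment> \<open>As \<open>f w\<close> and \<open>w\<close> have equal norm, the component
          of \<open>f w\<close> along \<open>?d\<close> is half of \<open>?d\<close>, so the
          reflection takes \<open>f w\<close> to \<open>w\<close>.\<close>
        have d: "?d \<bullet> ?d = 2 * (?d \<bullet> f w)"
          using inner[of w w] by (simp add: algebra_simps inner_commute)
        have "2 * (v \<bullet> f w) / norm ?d = 2 * (?d \<bullet> f w) / (?d \<bullet> ?d)"
          by (simp add: v_def dot_square_norm power2_eq_square)
        also have "\<dots> = 1"
        proof -
          have "?d \<bullet> ?d \<noteq> 0" using w by simp
          then show ?thesis unfolding d by (rule divide_self)
        qed
        finally have 1: "2 * (v \<bullet> f w) / norm ?d = 1" .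
        have "(2 * (v \<bullet> f w)) *\<^sub>R v = (2 * (v \<bullet> f w) / norm ?d) *\<^sub>R ?d"
          by (subst (2) v_def) simp
        then have "(2 * (v \<bullet> f w)) *\<^sub>R v = ?d" unfolding 1 by simp
        then show ?thesis by (simp add: g_def reflection_def)
      qed
      have sub: "subspace {u. f u = u}" using lin
        by (auto simp: subspace_def linear_0 linear_add linear_scale)
      have subg: "subspace {u. g u = u}" using og
        by (auto simp: orthogonal_transformation_def subspace_def linear_0 linear_add linear_scale)
      have "{u. f u = u} \<subset> {u. g u = u}" using fixf fixw w by auto
      then have "dim {u. f u = u} < dim {u. g u = u}"
        using sub subg by (metis dim_psubset span_eq_iff)
      moreover have "dim {u. g u = u} \<le> DIM('a)" by (rule dim_subset_UNIV)
      ultimately have "DIM('a) - dim {u. g u = u} < DIM('a) - dim {u. f u = u}" by linarith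
      from less.hyps[OF this og] obtain vs where vs: "\<forall>v\<in>set vs. norm v = 1" "reflections vs = g" by blast
      have "reflections (v # vs) = f"
        using nv vs(2) by (auto simp: fun_eq_iff g_def reflection_involution)
      then show ?thesis using nv vs(1) by (intro exI[of _ "v # vs"]) auto
    qed
  qed
  then show thesis using that by blast
qed

section \<open>Orthogonal involutions and the squares of their lifts\<close>

lemma sorted_wrt_orthogonal_if_pairwise:
  "pairwise orthogonal (set vs) \<Longrightarrow> distinct vs \<Longrightarrow> sorted_wrt orthogonal vs"
  by (induction vs) (auto simp: pairwise_insert)

lemma reflections_orthonormal:
  assumes "sorted_wrt orthogonal vs"
  shows "reflections vs w = w - (\<Sum>v\<leftarrow>vs. (2 * (v \<bullet> w)) *\<^sub>R v)"
  using assms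
proof (induction vs)
  case (Cons v vs)
  have "v \<bullet> (\<Sum>u\<leftarrow>us. (2 * (u \<bullet> w)) *\<^sub>R u) = 0" if "\<forall>u\<in>set us. orthogonal v u" for us
    using that by (induction us) (auto simp: inner_add_right orthogonal_def)
  then show ?case using Cons by (simp add: reflection_def inner_diff_right)
qed simp

lemma vec_prod_anticommute:
  assumes "\<forall>u\<in>set vs. orthogonal v u"
  shows "vec_prod vs * vec_cliff v = (-1) ^ length vs * (vec_cliff v * vec_prod vs)"
  using assms
proof (induction vs)
  case (Cons u vs)
  let ?s = "(-1 :: 'a cliff) ^ length vs"
  \<comment> \<open>The sign is an element of a noncommutative ring, so its centrality has to be
    stated.\<close>
  have s: "a * (?s * b) = ?s * (a * b)" for a b
    by (cases "even (length vs)") simp_all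
  have uv: "vec_cliff u * vec_cliff v = - (vec_cliff v * vec_cliff u)"
    using vec_cliff_anticommute[of u v] Cons.prems
    by (simp add: orthogonal_def inner_commute eq_neg_iff_add_eq_0)
  have "vec_prod (u # vs) * vec_cliff v = vec_cliff u * (vec_prod vs * vec_cliff v)"
    by (simp add: mult.assoc)
  also have "\<dots> = ?s * ((vec_cliff u * vec_cliff v) * vec_prod vs)"
    using Cons by (simp add: s mult.assoc)
  also have "\<dots> = - (?s * (vec_cliff v * vec_prod (u # vs)))" by (simp add: uv mult.assoc)
  finally show ?case by simp
qed simp

text \<open>For m vectors there are m(m-1)/2 swaps and m squares equal to -1. Kept as a sum, the
  exponent grows by \<open>length vs + 1\<close> in the induction and no division occurs.\<close>

lemma vec_prod_orthonormal_square:
  assumes "unit_vectors vs" "sorted_wrt orthogonal vs"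
  shows "vec_prod vs * vec_prod vs = (-1) ^ (\<Sum>{..length vs})"
  using assms
proof (induction vs)
  case (Cons v vs)
  let ?x = "vec_prod vs" and ?v = "vec_cliff v" and ?s = "(-1 :: 'a cliff) ^ length vs"
  have s: "a * (?s * b) = ?s * (a * b)" for a b
    by (cases "even (length vs)") simp_all
  have "vec_prod (v # vs) * vec_prod (v # vs) = ?v * (?x * ?v) * ?x" by (simp add: mult.assoc)
  also have "\<dots> = ?v * (?s * (?v * ?x)) * ?x" using Cons.prems by (simp add: vec_prod_anticommute)
  also have "\<dots> = ?s * ((?v * ?v) * (?x * ?x))" by (simp add: s mult.assoc)
  also have "?v * ?v = -1" using Cons.prems by (simp add: vec_cliff_square)
  also have "?x * ?x = (-1) ^ (\<Sum>{..length vs})" using Cons by simp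
  also have "?s * (-1 * (-1) ^ (\<Sum>{..length vs})) = (-1) ^ (\<Sum>{..length (v # vs)})"
    by (simp flip: power_add power_Suc add: add_ac)
  finally show ?case .
qed simp

text \<open>As \<open>f\<close> preserves inner products, its fixed vectors are orthogonal to the
  basis \<open>B\<close> of the -1 eigenspace, so the reflections fix them too. Any \<open>w\<close>
  is half the sum of the fixed vector \<open>w + f w\<close> and the negated vector
  \<open>w - f w\<close>. Each unit vector in \<open>B\<close> lowers the trace by 2.\<close>

lemma orthogonal_involution_eq_reflections:
  fixes f :: "real^'n::finite \<Rightarrow> real^'n"
  assumes f: "orthogonal_transformation f" and inv: "f \<circ> f = id"
  obtains vs where "unit_vectors vs" "sorted_wrt orthogonal vs" "reflections vs = f"
    "trace (matrix f) = real CARD('n) - 2 * real (length vs)"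
proof -
  have lin: "linear f" and inner: "\<And>x y. f x \<bullet> f y = x \<bullet> y"
    using f by (auto simp: orthogonal_transformation_def)
  have ff: "f (f x) = x" for x using inv by (metis comp_apply id_apply)
  let ?W = "{w. f w = - w}"
  have "subspace ?W" using lin by (auto simp: subspace_def linear_0 linear_add linear_scale)
  then obtain B where B: "B \<subseteq> ?W" "pairwise orthogonal B" "\<And>x. x \<in> B \<Longrightarrow> norm x = 1"
    "independent B" "span B = ?W"
    by (rule orthonormal_basis_subspace) blast
  have "finite B" using B(4) by (rule independent_imp_finite)
  then obtain vs where vs: "set vs = B" "distinct vs" using finite_distinct_list by blast
  have u: "unit_vectors vs" using B(3) vs(1) by simp
  have s: "sorted_wrt orthogonal vs"
    using B(2) vs(2) unfolding vs(1)[symmetric] by (rule sorted_wrt_orthogonal_if_pairwise)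
  have refl: "reflections vs w = w - (\<Sum>v\<in>B. (2 * (v \<bullet> w)) *\<^sub>R v)" for w
    by (simp add: reflections_orthonormal[OF s] sum_list_distinct_conv_sum_set[OF vs(2)] vs(1))
  have onB: "reflections vs b = - b" if "b \<in> B" for b
  proof -
    have "b \<bullet> b = 1" using B(3)[OF that] by (simp only: norm_eq_1)
    moreover have "v \<bullet> b = 0" if "v \<in> B" "v \<noteq> b" for v
      using pairwiseD[OF B(2) that(1) \<open>b \<in> B\<close> that(2)] by (simp only: orthogonal_def)
    ultimately have "(\<Sum>v\<in>B. (2 * (v \<bullet> b)) *\<^sub>R v) = (\<Sum>v\<in>B. if v = b then 2 *\<^sub>R b else 0)"
      by (intro sum.cong) simp_all
    also have "\<dots> = 2 *\<^sub>R b" using \<open>finite B\<close> that by simp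
    finally show ?thesis by (simp add: refl scaleR_2)
  qed
  have onW: "reflections vs d = f d" if "d \<in> ?W" for d
    by (rule linear_eq_on[OF linear_reflections lin, of d B]) (use that B onB in auto)
  have onU: "reflections vs a = f a" if "f a = a" for a
  proof -
    have "v \<bullet> a = 0" if "v \<in> B" for v
    proof -
      have "f v \<bullet> f a = - (v \<bullet> a)" using that B(1) \<open>f a = a\<close> by auto
      then show ?thesis using inner by simp
    qed
    then show ?thesis using that by (simp add: refl)
  qed
  have eq: "reflections vs = f"
  proof
    fix w
    have w: "w = (1/2) *\<^sub>R (w + f w) + (1/2) *\<^sub>R (w - f w)"
      by (simp add: algebra_simps flip: scaleR_left_distrib)
    have "reflections vs (w + f w) = f (w + f w)"
      using lin ff by (intro onU) (simp add: linear_add add.commute)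
    moreover have "reflections vs (w - f w) = f (w - f w)"
      using lin ff by (intro onW) (simp add: linear_diff)
    ultimately show "reflections vs w = f w"
      by (subst (1 2) w) (simp only: linear_add[OF lin] linear_add[OF linear_reflections]
        linear_scale[OF lin] linear_scale[OF linear_reflections])
  qed
  have "trace (matrix f) = (\<Sum>i\<in>UNIV. f (axis i 1) $ i)"
    by (simp add: trace_def matrix_def)
  also have "\<dots> = (\<Sum>i\<in>UNIV. 1 - (\<Sum>v\<in>B. 2 * (v $ i * v $ i)))"
    unfolding eq[symmetric] refl by (simp add: inner_axis sum_component mult.assoc)
  also have "\<dots> = real CARD('n) - (\<Sum>i\<in>UNIV. \<Sum>v\<in>B. 2 * (v $ i * v $ i))"
    by (simp add: sum_subtractf)
  also have "(\<Sum>i\<in>UNIV. \<Sum>v\<in>B. 2 * (v $ i * v $ i)) = (\<Sum>v\<in>B. 2 * (v \<bullet> v))"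
    by (subst sum.swap) (simp add: inner_vec_def sum_distrib_left)
  also have "\<dots> = 2 * real (length vs)"
    using B(3) distinct_card[OF vs(2)] vs(1) by (simp add: norm_eq_1)
  finally show thesis using that u s eq by blast
qed

section \<open>Lifting representations\<close>

lemma cliff_one_neq_minus_one: "(1 :: 'n::{finite,linorder} cliff) \<noteq> -1"
proof
  assume "(1 :: 'n cliff) = -1"
  then have "coeff (1 :: 'n cliff) {} = coeff (-1 :: 'n cliff) {}" by simp
  then show False by (simp add: coeff_one cl_one_def)
qed

lemma grade_vec_prod: "grade (vec_prod vs) = (-1) ^ length vs * vec_prod vs"
proof (induction vs)
  case (Cons v vs)
  let ?s = "(-1 :: 'a cliff) ^ length vs"
  have s: "a * (?s * b) = ?s * (a * b)" for a b
    by (cases "even (length vs)") simp_all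
  show ?case by (simp add: grade_mult grade_vec_cliff Cons s)
qed (simp add: grade_one)

lemma even_sum_atMost_iff: "even (\<Sum>{..m}) \<longleftrightarrow> m mod 4 = 0 \<or> m mod 4 = (3 :: nat)"
proof (induction m)
  case (Suc m)
  then have "even (\<Sum>{..Suc m}) \<longleftrightarrow> (m mod 4 = 0 \<or> m mod 4 = 3) = even (Suc m)"
    by simp
  then show ?case by presburger
qed simp

text \<open>Membership in the carrier is included so that the composition law of
  \<open>alt_cover\<close> holds without side conditions.\<close>

definition pin_lift :: "('g, 'b) monoid_scheme \<Rightarrow> ('g \<Rightarrow> real^'n::{finite,linorder} \<Rightarrow> real^'n::{finite,linorder}) \<Rightarrow>
    'g \<Rightarrow> 'n::{finite,linorder} cliff \<Rightarrow> bool" where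
  "pin_lift G \<pi> p x \<longleftrightarrow> p \<in> carrier G \<and> coeff x \<in> Pin \<and> pin_rho (coeff x) = \<pi> p"

lemma pin_lift_iff:
  "pin_lift G \<pi> p x \<longleftrightarrow> p \<in> carrier G \<and> (\<exists>vs. unit_vectors vs \<and> x = vec_prod vs \<and> reflections vs = \<pi> p)"
  unfolding pin_lift_def coeff_in_Pin_iff using pin_rho_vec_prod by metis

lemma spinorial_iff_pin_lift:
  "spinorial G \<pi> \<longleftrightarrow> (\<exists>f. (\<forall>p\<in>carrier G. pin_lift G \<pi> p (f p)) \<and>
    (\<forall>p\<in>carrier G. \<forall>q\<in>carrier G. f (p \<otimes>\<^bsub>G\<^esub> q) = f p * f q))"
proof
  assume "spinorial G \<pi>"
  then obtain h where h: "\<forall>g\<in>carrier G. h g \<in> Pin"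
    "\<forall>g\<in>carrier G. \<forall>k\<in>carrier G. h (g \<otimes>\<^bsub>G\<^esub> k) = cl_mult (h g) (h k)"
    "\<forall>g\<in>carrier G. pin_rho (h g) = \<pi> g"
    unfolding spinorial_def by blast
  then show "\<exists>f. (\<forall>p\<in>carrier G. pin_lift G \<pi> p (f p)) \<and>
      (\<forall>p\<in>carrier G. \<forall>q\<in>carrier G. f (p \<otimes>\<^bsub>G\<^esub> q) = f p * f q)"
    by (intro exI[of _ "\<lambda>p. Cliff (h p)"]) (simp add: pin_lift_def times_cliff_def)
next
  assume "\<exists>f. (\<forall>p\<in>carrier G. pin_lift G \<pi> p (f p)) \<and>
      (\<forall>p\<in>carrier G. \<forall>q\<in>carrier G. f (p \<otimes>\<^bsub>G\<^esub> q) = f p * f q)"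
  then obtain f where f: "\<forall>p\<in>carrier G. pin_lift G \<pi> p (f p)"
    "\<forall>p\<in>carrier G. \<forall>q\<in>carrier G. f (p \<otimes>\<^bsub>G\<^esub> q) = f p * f q" by blast
  then show "spinorial G \<pi>"
    unfolding spinorial_def by (intro exI[of _ "\<lambda>p. coeff (f p)"]) (simp add: pin_lift_def coeff_mult)
qed

section \<open>Orthogonal representations of the symmetric and alternating groups\<close>

locale perm_rep =
  fixes n :: nat and G :: "(nat \<Rightarrow> nat) monoid" and \<pi> :: "(nat \<Rightarrow> nat) \<Rightarrow> real^'m::{finite,linorder} \<Rightarrow> real^'m::{finite,linorder}"
  assumes rep: "orth_rep G \<pi>" and four: "n \<ge> 4" and G_cases: "G = sym_group n \<or> G = alt_group n"
begin

lemma G_mult: "p \<otimes>\<^bsub>G\<^esub> q = p \<circ> q" and G_one: "\<one>\<^bsub>G\<^esub> = id"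
  using G_cases by (auto simp: sym_group_mult alt_group_mult sym_group_one alt_group_one)

lemma id_in: "id \<in> carrier G" and comp_in: "p \<in> carrier G \<Longrightarrow> q \<in> carrier G \<Longrightarrow> p \<circ> q \<in> carrier G"
proof -
  have "group G" using rep by (simp add: orth_rep_def)
  then interpret group G .
  show "id \<in> carrier G" using one_closed G_one by simp
  show "p \<in> carrier G \<Longrightarrow> q \<in> carrier G \<Longrightarrow> p \<circ> q \<in> carrier G" using m_closed G_mult by metis
qed

lemma alt_subset: "p \<in> carrier (alt_group n) \<Longrightarrow> p \<in> carrier G"
  using G_cases by (auto simp: sym_group_carrier alt_group_carrier)

lemma pi_comp: "p \<in> carrier G \<Longrightarrow> q \<in> carrier G \<Longrightarrow> \<pi> (p \<circ> q) = \<pi> p \<circ> \<pi> q"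
  using rep by (auto simp: orth_rep_def G_mult)

lemma pi_orthogonal: "p \<in> carrier G \<Longrightarrow> orthogonal_transformation (\<pi> p)"
  using rep by (auto simp: orth_rep_def)

text \<open>\<open>orth_rep\<close> does not list this; it holds because an injective idempotent map
  is the identity.\<close>

lemma pi_id: "\<pi> id = id"
proof
  fix w
  have "inj (\<pi> id)" using pi_orthogonal[OF id_in] by (rule orthogonal_transformation_inj)
  moreover have "\<pi> id (\<pi> id w) = \<pi> id w" using pi_comp[OF id_in id_in] by (metis comp_apply comp_id)
  ultimately show "\<pi> id w = id w" by (metis injD id_apply)
qed

abbreviation L where "L \<equiv> pin_lift G \<pi>"

lemma pin_lift_comp:
  assumes "L p x" "L q y" shows "L (p \<circ> q) (x * y)"
proof -
  obtain vs ws where vs: "unit_vectors vs" "x = vec_prod vs" "reflections vs = \<pi> p"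
    and ws: "unit_vectors ws" "y = vec_prod ws" "reflections ws = \<pi> q"
    using assms unfolding pin_lift_iff by blast
  have "reflections (vs @ ws) = \<pi> (p \<circ> q)"
    using assms pi_comp[of p q] vs(3) ws(3) by (auto simp: pin_lift_iff fun_eq_iff)
  then show ?thesis using assms vs ws comp_in unfolding pin_lift_iff
    by (auto intro!: exI[of _ "vs @ ws"])
qed

lemma pin_lift_uminus:
  assumes "L p x" shows "L p (- x)"
proof -
  obtain vs where vs: "unit_vectors vs" "x = vec_prod vs" "reflections vs = \<pi> p"
    using assms unfolding pin_lift_iff by blast
  \<comment> \<open>A unit vector squares to -1 and its reflection to the identity, so inserting it
    twice changes only the sign. It exists because index types are nonempty.\<close>
  obtain e :: "real^'m::{finite,linorder}" where e: "norm e = 1" using norm_axis_1 by blast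
  have "vec_prod (e # e # vs) = (vec_cliff e * vec_cliff e) * vec_prod vs" by (simp add: mult.assoc)
  then have "- x = vec_prod (e # e # vs)" using e by (simp add: vec_cliff_square vs(2))
  moreover have "reflections (e # e # vs) = \<pi> p"
    using e vs(3) by (auto simp: fun_eq_iff reflection_involution)
  moreover have "unit_vectors (e # e # vs)" using e vs(1) by simp
  ultimately show ?thesis using assms unfolding pin_lift_iff by blast
qed

sublocale alt_cover n L
proof
  show "L (p \<circ> q) (x * y)" if "L p x" "L q y" for p x q y using that by (rule pin_lift_comp)
  show "L p (- x)" if "L p x" for p x using that by (rule pin_lift_uminus)
  show "L id 1"
    unfolding pin_lift_iff using id_in by (intro conjI exI[of _ "[]"]) (auto simp: fun_eq_iff pi_id)
  show "x = 1 \<or> x = -1" if "L id x" for x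
    using that pin_rho_kernel unfolding pin_lift_iff pi_id by (metis id_apply)
  show "(1 :: 'm cliff) \<noteq> -1" by (rule cliff_one_neq_minus_one)
  show "\<exists>x. L p x" if "p \<in> carrier (alt_group n)" for p
    using that alt_subset pi_orthogonal orthogonal_transformation_eq_reflections
    unfolding pin_lift_iff by metis
qed

lemma involution_lift:
  assumes "p \<in> carrier G" "p \<circ> p = id"
  obtains m x where "L p x" "character \<pi> id - character \<pi> p = 2 * real m"
    "x * x = (-1) ^ (\<Sum>{..m})" "grade x = (-1) ^ m * x"
proof -
  have "\<pi> p \<circ> \<pi> p = id" using pi_comp[OF assms(1,1)] assms(2) pi_id by simp
  then obtain vs where vs: "unit_vectors vs" "sorted_wrt orthogonal vs" "reflections vs = \<pi> p"
    "trace (matrix (\<pi> p)) = real CARD('m) - 2 * real (length vs)"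
    using orthogonal_involution_eq_reflections[OF pi_orthogonal[OF assms(1)]] by metis
  have "character \<pi> id = real CARD('m)"
    by (simp add: character_def pi_id matrix_id_mat_1 trace_I)
  then have "character \<pi> id - character \<pi> p = 2 * real (length vs)"
    using vs(4) by (simp add: character_def)
  then show thesis
    using that[of "vec_prod vs" "length vs"] vs assms(1) vec_prod_orthonormal_square grade_vec_prod
    unfolding pin_lift_iff by blast
qed

text \<open>The argument uses \<open>p \<circ> p = id\<close> because \<open>p\<close> may be odd,
  whereas \<open>L_unique\<close> covers the alternating group only.\<close>

lemma involution_square_eq:
  assumes "L p x" "L p y" "p \<circ> p = id"
  shows "y * y = x * x"
proof -
  have "x * x = 1 \<or> x * x = -1" "x * y = 1 \<or> x * y = -1"
    using pin_lift_comp assms L_id_cases by metis+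
  moreover have "x * (x * y) = (x * x) * y" by (simp only: mult.assoc)
  ultimately have "y = x \<or> y = - x" by (auto simp: minus_equation_iff)
  then show ?thesis by auto
qed

lemma square_one_iff:
  assumes "p \<in> carrier G" "p \<circ> p = id" "character \<pi> id - character \<pi> p = 2 * real m" "L p y"
  shows "y * y = 1 \<longleftrightarrow> m mod 4 = 0 \<or> m mod 4 = 3"
proof -
  obtain k x where x: "L p x" "character \<pi> id - character \<pi> p = 2 * real k" "x * x = (-1) ^ (\<Sum>{..k})"
    using involution_lift[OF assms(1,2)] by metis
  have k: "k = m" using x(2) assms(3) by simp
  have "y * y = 1 \<longleftrightarrow> (-1 :: 'm cliff) ^ (\<Sum>{..m}) = 1"
    using involution_square_eq[OF x(1) assms(4,2)] x(3) k by simp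
  also have "\<dots> \<longleftrightarrow> even (\<Sum>{..m})"
    using cliff_one_neq_minus_one by (cases "even (\<Sum>{..m})") auto
  finally show ?thesis by (simp only: even_sum_atMost_iff)
qed

text \<open>\<open>grade\<close> multiplies a product of vectors by a sign. A minus sign would
  survive in the cube, which is 1 and is fixed by \<open>grade\<close>.\<close>

lemma grade_C:
  assumes "{a, b, c} \<subseteq> {1..n}" "distinct [a, b, c]"
  shows "grade (C a b c) = C a b c"
proof -
  let ?x = "C a b c"
  obtain vs where "?x = vec_prod vs" using L_C[OF assms] unfolding pin_lift_iff by blast
  then have "grade ?x = (-1) ^ length vs * ?x" using grade_vec_prod by metis
  then have "grade ?x = ?x \<or> grade ?x = - ?x" by (cases "even (length vs)") auto
  moreover have "grade ?x \<noteq> - ?x"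
  proof
    assume "grade ?x = - ?x"
    then have "grade (?x * ?x * ?x) = - (?x * ?x * ?x)" by (simp add: grade_mult)
    then show False using cliff_one_neq_minus_one C_cube[OF assms] by (simp add: grade_one)
  qed
  ultimately show ?thesis by blast
qed

abbreviation double_transposition :: "nat \<Rightarrow> nat" where
  "double_transposition \<equiv> Transposition.transpose 1 2 \<circ> Transposition.transpose 3 4"

text \<open>The factorisation behind \<open>C_mult_square\<close>, at the points 1, 3, 2, 4.\<close>

lemma double_transposition_eq: "double_transposition = cyc3 1 3 2 \<circ> cyc3 1 3 4"
  by (auto simp: fun_eq_iff cyc3_apply Transposition.transpose_def)

lemma double_transposition_alt: "double_transposition \<in> carrier (alt_group n)"
proof -
  interpret A: group "alt_group n" by (rule alt_group_is_group)
  have "cyc3 1 3 2 \<in> carrier (alt_group n)" "cyc3 1 3 4 \<in> carrier (alt_group n)"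
    using four by (auto intro!: cyc3_in_alt)
  then show ?thesis unfolding double_transposition_eq using A.m_closed alt_group_mult by metis
qed

lemma double_transposition_involution: "double_transposition \<circ> double_transposition = id"
  by (auto simp: fun_eq_iff Transposition.transpose_def)

text \<open>Products of 3-cycles lift to the even part, so only multiples of 4 survive in
  \<open>square_one_iff\<close> for the double transposition.\<close>

lemma double_transposition_square_iff:
  assumes "L double_transposition y"
  shows "y * y = 1 \<longleftrightarrow> (\<exists>k::int. character \<pi> id - character \<pi> double_transposition = 8 * k)"
proof -
  obtain m x where x: "L double_transposition x"
    "character \<pi> id - character \<pi> double_transposition = 2 * real m" "grade x = (-1) ^ m * x"
    using involution_lift[OF alt_subset[OF double_transposition_alt] double_transposition_involution] by metis
  have "even m"
  proof (rule ccontr)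
    assume "odd m"
    then have neg: "grade x = - x" using x(3) by simp
    \<comment> \<open>A lift fixed by \<open>grade\<close>. The lift \<open>x\<close> equals it up
      to sign, so \<open>grade\<close> cannot negate \<open>x\<close>.\<close>
    let ?y = "C 1 3 2 * C 1 3 4"
    have in_n: "{1, 3, 2} \<subseteq> {1..n}" "{1, 3, 4} \<subseteq> {1..n}" using four by auto
    have Ly: "L double_transposition ?y" unfolding double_transposition_eq
      by (intro L_comp L_C in_n) simp_all
    have gy: "grade ?y = ?y" using grade_C[OF in_n(1)] grade_C[OF in_n(2)] by (simp add: grade_mult)
    have "x = ?y \<or> x = - ?y" by (rule L_unique[OF double_transposition_alt Ly x(1)])
    then have "grade x = x" using gy by (auto simp: grade_minus)
    then have "x * x = - (x * x)" using neg by (metis minus_mult_right)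
    moreover have "x * x = 1 \<or> x * x = -1"
      using L_id_cases L_comp[OF x(1,1)] double_transposition_involution by metis
    ultimately show False using cliff_one_neq_minus_one by auto
  qed
  then have "y * y = 1 \<longleftrightarrow> 4 dvd m"
    using square_one_iff[OF alt_subset[OF double_transposition_alt] double_transposition_involution x(2) assms]
    by presburger
  also have "\<dots> \<longleftrightarrow> (\<exists>k::int. 2 * real m = 8 * real_of_int k)"
  proof
    assume "4 dvd m"
    then obtain k where "m = 4 * k" by (elim dvdE)
    then show "\<exists>k::int. 2 * real m = 8 * real_of_int k" by (intro exI[of _ "int k"]) simp
  next
    assume "\<exists>k::int. 2 * real m = 8 * real_of_int k"
    then obtain k :: int where "2 * real m = 8 * real_of_int k" by blast
    then have "int m = 4 * k" by linarith
    then show "4 dvd m" by presburger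
  qed
  finally show ?thesis by (simp only: x(2))
qed

lemma split_alt_coverI:
  assumes "\<exists>k::int. character \<pi> id - character \<pi> double_transposition = 8 * k"
  shows "split_alt_cover n L"
  by unfold_locales (use four double_transposition_square_iff assms in auto)

text \<open>\<open>f id\<close> is idempotent and equals 1 or -1, so it is 1.\<close>

lemma section_involution:
  assumes "\<forall>p\<in>carrier G. L p (f p)" "\<forall>p\<in>carrier G. \<forall>q\<in>carrier G. f (p \<otimes>\<^bsub>G\<^esub> q) = f p * f q"
    and "p \<in> carrier G" "p \<circ> p = id"
  shows "f p * f p = 1"
proof -
  have "f id * f id = f (id \<otimes>\<^bsub>G\<^esub> id)" using assms(2) id_in by metis
  then have "f id * f id = f id" by (simp add: G_mult)
  moreover have "f id = 1 \<or> f id = -1" using assms(1) id_in L_id_cases by blast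
  ultimately have "f id = 1" by auto
  moreover have "f p * f p = f (p \<otimes>\<^bsub>G\<^esub> p)" using assms(2,3) by metis
  ultimately show ?thesis by (simp add: G_mult assms(4))
qed

lemma spinorial_double_transposition:
  assumes "spinorial G \<pi>"
  shows "\<exists>k::int. character \<pi> id - character \<pi> double_transposition = 8 * k"
proof -
  obtain f where f: "\<forall>p\<in>carrier G. L p (f p)"
    "\<forall>p\<in>carrier G. \<forall>q\<in>carrier G. f (p \<otimes>\<^bsub>G\<^esub> q) = f p * f q"
    using assms unfolding spinorial_iff_pin_lift by blast
  have d: "double_transposition \<in> carrier G" by (rule alt_subset[OF double_transposition_alt])
  show ?thesis
    using section_involution[OF f d double_transposition_involution]
      double_transposition_square_iff f(1) d by blast
qed

end

section \<open>The two criteria\<close>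

lemma spinorial_alt_group_iff:
  fixes \<pi> :: "(nat \<Rightarrow> nat) \<Rightarrow> real^'m::{finite,linorder} \<Rightarrow> real^'m::{finite,linorder}"
  assumes "n \<ge> 4" "orth_rep (alt_group n) \<pi>"
  shows "spinorial (alt_group n) \<pi> \<longleftrightarrow> (\<exists>k::int. character \<pi> id -
    character \<pi> (Transposition.transpose 1 2 \<circ> Transposition.transpose 3 4) = 8 * k)"
proof -
  interpret perm_rep n "alt_group n" \<pi> using assms by unfold_locales auto
  show ?thesis
  proof (intro iffI spinorial_double_transposition)
    assume "\<exists>k::int. character \<pi> id - character \<pi> double_transposition = 8 * k"
    then interpret split_alt_cover n L by (rule split_alt_coverI)
    show "spinorial (alt_group n) \<pi>"
      unfolding spinorial_iff_pin_lift using L_sect sect_comp by (metis alt_group_mult)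
  qed
qed

text \<open>Beyond the section over the alternating group, one odd involution with a lift of square
  1 is required. The condition on the character at the transposition of 1 and 2 says that its lifts
  have square 1.\<close>

lemma spinorial_sym_group_iff:
  fixes \<pi> :: "(nat \<Rightarrow> nat) \<Rightarrow> real^'m::{finite,linorder} \<Rightarrow> real^'m::{finite,linorder}"
  assumes "n \<ge> 4" "orth_rep (sym_group n) \<pi>"
  shows "spinorial (sym_group n) \<pi> \<longleftrightarrow>
    (\<exists>k::int. character \<pi> id -
      character \<pi> (Transposition.transpose 1 2 \<circ> Transposition.transpose 3 4) = 8 * k) \<and>
    (\<exists>k::int. character \<pi> id - character \<pi> (Transposition.transpose 1 2) = 8 * k \<or>
      character \<pi> id - character \<pi> (Transposition.transpose 1 2) = 8 * k + 6)"
    (is "_ \<longleftrightarrow> ?double \<and> ?single")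
proof -
  interpret perm_rep n "sym_group n" \<pi> using assms by unfold_locales auto
  let ?s = "Transposition.transpose 1 (2 :: nat)"
  have perm: "?s permutes {1..n}" using assms(1) by (intro permutes_swap_id) auto
  then have s: "?s \<in> carrier (sym_group n)" by (simp add: sym_group_carrier)
  have ss: "?s \<circ> ?s = id" by simp
  have odd: "\<not> evenperm ?s" by (simp add: evenperm_swap)
  obtain m t where t: "L ?s t" "character \<pi> id - character \<pi> ?s = 2 * real m"
    using involution_lift[OF s ss] by metis
  have "m mod 4 = 0 \<or> m mod 4 = 3 \<longleftrightarrow>
      (\<exists>k::int. 2 * real m = 8 * real_of_int k \<or> 2 * real m = 8 * real_of_int k + 6)"
  proof
    assume "m mod 4 = 0 \<or> m mod 4 = 3"
    then have "m = 4 * (m div 4) \<or> m = 4 * (m div 4) + 3" by presburger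
    then show "\<exists>k::int. 2 * real m = 8 * real_of_int k \<or> 2 * real m = 8 * real_of_int k + 6"
      by (intro exI[of _ "int (m div 4)"]) linarith
  next
    assume "\<exists>k::int. 2 * real m = 8 * real_of_int k \<or> 2 * real m = 8 * real_of_int k + 6"
    then obtain k :: int where "2 * real m = 8 * real_of_int k \<or> 2 * real m = 8 * real_of_int k + 6"
      by blast
    then have "int m = 4 * k \<or> int m = 4 * k + 3" by linarith
    then show "m mod 4 = 0 \<or> m mod 4 = 3" by presburger
  qed
  then have single: "y * y = 1 \<longleftrightarrow> ?single" if "L ?s y" for y
    using square_one_iff[OF s ss t(2) that] by (simp only: t(2))
  show ?thesis
  proof
    assume *: "spinorial (sym_group n) \<pi>"
    then obtain f where f: "\<forall>p\<in>carrier (sym_group n). L p (f p)"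
      "\<forall>p\<in>carrier (sym_group n). \<forall>q\<in>carrier (sym_group n). f (p \<otimes>\<^bsub>sym_group n\<^esub> q) = f p * f q"
      unfolding spinorial_iff_pin_lift by blast
    have ?single using section_involution[OF f s ss] single f(1) s by blast
    then show "?double \<and> ?single" using spinorial_double_transposition[OF *] by blast
  next
    assume *: "?double \<and> ?single"
    then interpret split_alt_cover n L by (intro split_alt_coverI) blast
    have tt: "t * t = 1" using single[OF t(1)] * by blast
    note sec = perm odd ss t(1) tt
    show "spinorial (sym_group n) \<pi>"
      unfolding spinorial_iff_pin_lift
      using L_sym_sect[OF sec] sym_sect_comp[OF sec]
      by (intro exI[of _ "sym_sect ?s t"]) (simp add: sym_group_carrier sym_group_mult)
  qed
qed

theorem theorem1p1:
  fixes n :: nat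
  assumes "n \<ge> 4"
  shows
   "(\<forall>\<pi> :: (nat \<Rightarrow> nat) \<Rightarrow> real^'m::{finite,linorder} \<Rightarrow> real^'m::{finite,linorder}.
       orth_rep (sym_group n) \<pi> \<longrightarrow>
       (spinorial (sym_group n) \<pi> \<longleftrightarrow>
          (\<exists>k::int. character \<pi> id - character \<pi> (s_transp 1 \<circ> s_transp 3) = 8 * k) \<and>
          (\<exists>k::int. character \<pi> id - character \<pi> (s_transp 1) = 8 * k \<or>
                    character \<pi> id - character \<pi> (s_transp 1) = 8 * k + 6)))
    \<and>
    (\<forall>\<pi> :: (nat \<Rightarrow> nat) \<Rightarrow> real^'m::{finite,linorder} \<Rightarrow> real^'m::{finite,linorder}.
       orth_rep (alt_group n) \<pi> \<longrightarrow>
       (spinorial (alt_group n) \<pi> \<longleftrightarrow>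
          (\<exists>k::int. character \<pi> id - character \<pi> (s_transp 1 \<circ> s_transp 3) = 8 * k)))"
proof -
  have "1 + 1 = (2 :: nat)" "3 + 1 = (4 :: nat)" by simp_all
  then have s: "s_transp 1 = Transposition.transpose 1 2" "s_transp 3 = Transposition.transpose 3 4"
    by (simp_all only: s_transp_def)
  show ?thesis unfolding s
    by (intro conjI allI impI spinorial_sym_group_iff spinorial_alt_group_iff assms)
qed

end
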